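(* Let $H$ be a bipartite graph that is cyclically 3-connected. Then either $H$ is isomorphic to $K_{3,3}$, or $H$ is a subdivision of $K_4$, or $H$ has a subgraph $H'$ which is a subdivision of $K_4$ such that no cycle of $H'$ has vertex set equal to the set of branch-vertices of $H'$.
   Context: Graphs are finite and simple. A graph is $3$-connected if it has more than $3$ vertices and remains connected after deleting any $2$ vertices. A subdivision of a graph $J$ is obtained by replacing each edge $uv$ of $J$ by a path from $u$ to $v$, these paths being internally vertex-disjoint. $H$ is cyclically 3-connected if it is (isomorphic to) a subdivision of some 3-connected graph. A branch-vertex of a graph is a vertex of degree at least $3$. *)

theory Defs
  imports Main
begin

text \<open>Finite simple graphs: a vertex set V and an edge set E of 2-element subsets of V.\<close>

definition graph :: "'a set \<Rightarrow> 'a set set \<Rightarrow> bool" where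
  "graph V E \<longleftrightarrow> finite V \<and> (\<forall>e\<in>E. e \<subseteq> V \<and> card e = 2)"

definition adj_rel :: "'a set set \<Rightarrow> ('a \<times> 'a) set" where
  "adj_rel E = {(x, y). {x, y} \<in> E}"

definition connected_graph :: "'a set \<Rightarrow> 'a set set \<Rightarrow> bool" where
  "connected_graph V E \<longleftrightarrow> (\<forall>u\<in>V. \<forall>v\<in>V. (u, v) \<in> (adj_rel E)\<^sup>*)"

text \<open>Deleting a vertex set S.\<close>
definition del_vertices :: "'a set \<Rightarrow> 'a set set \<Rightarrow> 'a set \<Rightarrow> 'a set \<times> 'a set set" where
  "del_vertices V E S = (V - S, {e\<in>E. e \<inter> S = {}})"

definition three_connected :: "'a set \<Rightarrow> 'a set set \<Rightarrow> bool" where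
  "three_connected V E \<longleftrightarrow> graph V E \<and> card V > 3 \<and>
     (\<forall>S\<subseteq>V. card S = 2 \<longrightarrow> connected_graph (V - S) {e\<in>E. e \<inter> S = {}})"

text \<open>A path in a graph, given by its list of (distinct) vertices, with at least one edge.\<close>
definition is_path :: "'a set set \<Rightarrow> 'a list \<Rightarrow> bool" where
  "is_path E xs \<longleftrightarrow> distinct xs \<and> length xs \<ge> 2 \<and>
     (\<forall>i. Suc i < length xs \<longrightarrow> {xs ! i, xs ! Suc i} \<in> E)"

definition path_edges :: "'a list \<Rightarrow> 'a set set" where
  "path_edges xs = {{xs ! i, xs ! Suc i} | i. Suc i < length xs}"

text \<open>A cycle, given by its cyclic list of distinct vertices (length at least 3).\<close>
definition is_cycle :: "'a set set \<Rightarrow> 'a list \<Rightarrow> bool" where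
  "is_cycle E xs \<longleftrightarrow> distinct xs \<and> length xs \<ge> 3 \<and>
     (\<forall>i<length xs. {xs ! i, xs ! ((Suc i) mod length xs)} \<in> E)"

text \<open>(V,E) is (isomorphic to) a subdivision of (VJ,EJ): the vertices of J are mapped injectively
  to branch points, each edge of J is replaced by a path between the images of its ends,
  these paths are internally disjoint and avoid other branch points, and (V,E) is exactly
  the union of these paths.\<close>
definition subdivision_of :: "'b set \<Rightarrow> 'b set set \<Rightarrow> 'a set \<Rightarrow> 'a set set \<Rightarrow> bool" where
  "subdivision_of VJ EJ V E \<longleftrightarrow> graph VJ EJ \<and> graph V E \<and>
     (\<exists>(\<phi>::'b \<Rightarrow> 'a) (P::'b set \<Rightarrow> 'a list).
        inj_on \<phi> VJ \<and> \<phi> ` VJ \<subseteq> V \<and>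
        (\<forall>e\<in>EJ. is_path E (P e) \<and> {hd (P e), last (P e)} = \<phi> ` e \<and>
                 set (P e) \<inter> \<phi> ` VJ = \<phi> ` e) \<and>
        (\<forall>e\<in>EJ. \<forall>e'\<in>EJ. e \<noteq> e' \<longrightarrow> set (P e) \<inter> set (P e') \<subseteq> \<phi> ` (e \<inter> e')) \<and>
        V = \<phi> ` VJ \<union> (\<Union>e\<in>EJ. set (P e)) \<and>
        E = (\<Union>e\<in>EJ. path_edges (P e)))"

text \<open>Cyclically 3-connected: a subdivision of some 3-connected graph. Such a graph J can
  always be relabelled inside the vertex type of H (its vertices embed into V), so we
  quantify over graphs J with vertex type 'a.\<close>
definition cyclically_3_connected :: "'a set \<Rightarrow> 'a set set \<Rightarrow> bool" where
  "cyclically_3_connected V E \<longleftrightarrow>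
     (\<exists>(VJ::'a set) EJ. three_connected VJ EJ \<and> subdivision_of VJ EJ V E)"

definition bipartite :: "'a set \<Rightarrow> 'a set set \<Rightarrow> bool" where
  "bipartite V E \<longleftrightarrow> (\<exists>A. \<forall>e\<in>E. card (e \<inter> A) = 1)"

definition subgraph :: "'a set \<Rightarrow> 'a set set \<Rightarrow> 'a set \<Rightarrow> 'a set set \<Rightarrow> bool" where
  "subgraph V' E' V E \<longleftrightarrow> graph V' E' \<and> V' \<subseteq> V \<and> E' \<subseteq> E"

definition degree :: "'a set set \<Rightarrow> 'a \<Rightarrow> nat" where
  "degree E v = card {e\<in>E. v \<in> e}"

definition branch_vertices :: "'a set \<Rightarrow> 'a set set \<Rightarrow> 'a set" where
  "branch_vertices V E = {v\<in>V. degree E v \<ge> 3}"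

definition K4_V :: "nat set" where "K4_V = {0..<4}"
definition K4_E :: "nat set set" where "K4_E = {{i, j} | i j. i < 4 \<and> j < 4 \<and> i \<noteq> j}"

definition K33_V :: "nat set" where "K33_V = {0..<6}"
definition K33_E :: "nat set set" where "K33_E = {{i, j} | i j. i < 3 \<and> 3 \<le> j \<and> j < 6}"

definition isomorphic :: "'b set \<Rightarrow> 'b set set \<Rightarrow> 'a set \<Rightarrow> 'a set set \<Rightarrow> bool" where
  "isomorphic V1 E1 V2 E2 \<longleftrightarrow> (\<exists>f. bij_betw f V1 V2 \<and> E2 = (\<lambda>e. f ` e) ` E1)"

end

theory Submission
  imports Defs "HOL-Library.Multiset"
begin

text \<open>Let \<open>H\<close> be a subdivision of the 3-connected graph \<open>J\<close>, and call an edge of \<open>J\<close> direct if it is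
  not subdivided in \<open>H\<close>. The argument takes place in \<open>J\<close>, of which only the bipartiteness of the
  direct edges is used, and \<open>K\<^sub>4\<close>-subdivisions of \<open>J\<close> are lifted to \<open>H\<close> at the end.

  A cycle of \<open>J\<close> avoiding a vertex \<open>u\<close>, together with a tripod in the component of \<open>u\<close>, is a
  subdivision of \<open>K\<^sub>4\<close>. Suppose that every such subdivision is degenerate, with direct edges
  \<open>ab\<close>, \<open>bc\<close>, \<open>cd\<close>, \<open>da\<close> and remaining paths \<open>P\<close> from \<open>a\<close> to \<open>c\<close> and \<open>Q\<close> from \<open>b\<close> to \<open>d\<close>. If \<open>J\<close>
  has a fifth vertex, \<open>P\<close> may be assumed to have an interior vertex after rerouting, and as
  \<open>J - {a, c}\<close> is connected there is a path from the interior of \<open>P\<close> to \<open>Q\<close>. Ending at \<open>b\<close> or \<open>d\<close>,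
  it gives a nondegenerate subdivision; ending inside \<open>Q\<close>, it gives a subdivision of \<open>K\<^sub>3\<^sub>,\<^sub>3\<close>. Deleting
  single paths from the latter shows that all its nine paths are direct edges, and any further
  path between two of its six vertices gives a nondegenerate subdivision, so \<open>J = H = K\<^sub>3\<^sub>,\<^sub>3\<close>.\<close>

section \<open>Walks and connectivity\<close>

abbreviation walk :: "'a set set \<Rightarrow> 'a list \<Rightarrow> bool" where
  "walk E \<equiv> successively (\<lambda>x y. {x, y} \<in> E)"

lemma walk_rev [simp]: "walk E (rev xs) = walk E xs"
  by (simp add: successively_rev insert_commute)

lemma walk_mono: "walk F xs \<Longrightarrow> F \<subseteq> E \<Longrightarrow> walk E xs"
  by (induction xs rule: induct_list012) auto

text \<open>The guard \<open>ys \<noteq> []\<close> keeps rewriting from looping on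
  \<open>xs @ [y]\<close>; the second form catches lists that start with a cons.\<close>

lemma walk_split:
  "ys \<noteq> [] \<Longrightarrow> walk E (xs @ y # ys) = (walk E (xs @ [y]) \<and> walk E (y # ys))"
  "ys \<noteq> [] \<Longrightarrow> walk E (x # xs @ y # ys) = (walk E (x # xs @ [y]) \<and> walk E (y # ys))"
  by (cases ys; cases xs; auto simp: successively_append_iff successively_Cons hd_append
        split: if_splits)+

text \<open>Transfers properties of all edges of a subgraph, such as avoiding deleted vertices, to
  the vertices of a walk in it.\<close>

lemma walk_in_edge:
  "walk F xs \<Longrightarrow> t \<in> set xs \<Longrightarrow> length xs \<ge> 2 \<Longrightarrow> \<exists>e\<in>F. t \<in> e"
proof (induction xs rule: induct_list012)
  case (3 x y zs)
  then show ?case by (cases zs) auto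
qed auto

lemma sym_adj_rel: "sym (adj_rel E)"
  by (auto simp: sym_def adj_rel_def insert_commute)

lemma adj_rtrancl_sym: "(x, y) \<in> (adj_rel E)\<^sup>* \<Longrightarrow> (y, x) \<in> (adj_rel E)\<^sup>*"
  by (meson sym_adj_rel sym_rtrancl symD)

lemma adj_rel_mono: "F \<subseteq> E \<Longrightarrow> adj_rel F \<subseteq> adj_rel E"
  by (auto simp: adj_rel_def)

lemma rtrancl_walk:
  "(u, v) \<in> (adj_rel F)\<^sup>* \<Longrightarrow> \<exists>xs. xs \<noteq> [] \<and> hd xs = u \<and> last xs = v \<and> walk F xs"
proof (induction rule: converse_rtrancl_induct)
  case base
  show ?case by (rule exI[of _ "[v]"]) simp
next
  case (step y z)
  then obtain xs where "xs \<noteq> []" "hd xs = z" "last xs = v" "walk F xs" by blast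
  with step(1) show ?case
    by (intro exI[of _ "y # xs"]) (auto simp: successively_Cons adj_rel_def)
qed

lemma walk_rtrancl:
  "walk F (x # xs) \<Longrightarrow> y \<in> set (x # xs) \<Longrightarrow> (x, y) \<in> (adj_rel F)\<^sup>*"
proof (induction xs arbitrary: x)
  case (Cons z xs)
  then have "(x, z) \<in> adj_rel F" by (auto simp: adj_rel_def)
  with Cons show ?case by (auto intro: converse_rtrancl_into_rtrancl)
qed auto

text \<open>Take a shortest walk from \<open>X\<close> to \<open>Y\<close>: a repeated vertex, or an
  inner vertex in \<open>X\<close> or \<open>Y\<close>, would allow a shorter one.\<close>

lemma link:
  assumes "(u, v) \<in> (adj_rel F)\<^sup>*" "u \<in> X" "v \<in> Y" "X \<inter> Y = {}"
  obtains x R y where "x \<in> X" "y \<in> Y" "distinct (x # R @ [y])" "walk F (x # R @ [y])"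
    "set R \<inter> (X \<union> Y) = {}"
proof -
  let ?P = "\<lambda>xs. xs \<noteq> [] \<and> hd xs \<in> X \<and> last xs \<in> Y \<and> walk F xs"
  have "\<exists>xs. ?P xs" using rtrancl_walk[OF assms(1)] assms(2,3) by blast
  then obtain xs where P: "?P xs" and least: "\<And>ys. ?P ys \<Longrightarrow> length xs \<le> length ys"
    using ex_has_least_nat[of ?P _ length] by blast
  obtain x ys where xs: "xs = x # ys" using P by (cases xs) auto
  have "ys \<noteq> []" using P assms(4) xs by auto
  then obtain R y where ys: "ys = R @ [y]" by (cases ys rule: rev_cases) auto
  have x: "x \<in> X" and y: "y \<in> Y" and w: "walk F (x # R @ [y])" using P xs ys by auto
  have "distinct xs"
  proof (rule ccontr)
    assume "\<not> distinct xs"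
    then obtain as w bs cs where d: "xs = as @ [w] @ bs @ [w] @ cs"
      using not_distinct_decomp by blast
    have "?P (as @ [w] @ cs)" using P unfolding d
      by (auto simp: successively_append_iff successively_Cons hd_append split: if_splits)
    from least[OF this] show False unfolding d by simp
  qed
  moreover have "set R \<inter> X = {}"
  proof (rule ccontr)
    assume "set R \<inter> X \<noteq> {}"
    then obtain r r1 r2 where r: "r \<in> X" "R = r1 @ r # r2" by (metis disjoint_iff split_list)
    have "?P (r # r2 @ [y])" using w y r by (auto simp: successively_append_iff successively_Cons)
    from least[OF this] show False unfolding xs ys r by simp
  qed
  moreover have "set R \<inter> Y = {}"
  proof (rule ccontr)
    assume "set R \<inter> Y \<noteq> {}"
    then obtain r r1 r2 where r: "r \<in> Y" "R = r1 @ r # r2" by (metis disjoint_iff split_list)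
    have "?P (x # r1 @ [r])" using w x r
      by (auto simp: successively_append_iff successively_Cons hd_append split: if_splits)
    from least[OF this] show False unfolding xs ys r by simp
  qed
  ultimately show thesis using that[of x y R] x y w xs ys by blast
qed

lemma link_ends:
  assumes "(u, v) \<in> (adj_rel F)\<^sup>*" "u \<noteq> v"
  obtains R where "distinct (u # R @ [v])" "walk F (u # R @ [v])"
proof -
  obtain x R y where "x \<in> {u}" "y \<in> {v}" "distinct (x # R @ [y])" "walk F (x # R @ [y])"
    by (rule link[OF assms(1), of "{u}" "{v}"]) (use assms(2) in simp_all)
  then show thesis using that[of R] by blast
qed

lemma simple_walk:
  assumes "(u, v) \<in> (adj_rel F)\<^sup>*"
  obtains xs where "xs \<noteq> []" "hd xs = u" "last xs = v" "distinct xs" "walk F xs"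
proof (cases "u = v")
  case True
  then show thesis using that[of "[u]"] by simp
next
  case False
  with assms obtain R where "distinct (u # R @ [v])" "walk F (u # R @ [v])" by (rule link_ends)
  then show thesis using that[of "u # R @ [v]"] by simp
qed

section \<open>3-connectivity and attachments of components\<close>

lemma graph_edge: "graph V E \<Longrightarrow> {x, y} \<in> E \<Longrightarrow> x \<in> V \<and> y \<in> V \<and> x \<noteq> y"
  by (cases "x = y") (auto simp: graph_def)

lemma three_connectedD:
  assumes "three_connected V E"
  shows "graph V E" "finite V" "card V > 3"
    "\<And>u v. u \<in> V \<Longrightarrow> v \<in> V \<Longrightarrow> u \<noteq> v \<Longrightarrow>
       connected_graph (V - {u, v}) {e\<in>E. e \<inter> {u, v} = {}}"
proof -
  show "graph V E" "finite V" "card V > 3"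
    using assms unfolding three_connected_def graph_def by blast+
  have *: "\<forall>S\<subseteq>V. card S = 2 \<longrightarrow> connected_graph (V - S) {e\<in>E. e \<inter> S = {}}"
    using assms unfolding three_connected_def by blast
  show "connected_graph (V - {u, v}) {e\<in>E. e \<inter> {u, v} = {}}"
    if "u \<in> V" "v \<in> V" "u \<noteq> v" for u v
    by (rule *[rule_format]) (use that in auto)
qed

text \<open>The neighbours in \<open>S\<close> of the component of \<open>v\<close> in the graph
  without \<open>S\<close>.\<close>

definition attachments :: "'a set set \<Rightarrow> 'a set \<Rightarrow> 'a \<Rightarrow> 'a set" where
  "attachments E S v =
     {s\<in>S. \<exists>k. (v, k) \<in> (adj_rel {e\<in>E. e \<inter> S = {}})\<^sup>* \<and> {s, k} \<in> E}"

text \<open>Were there at most two attachments, a 2-subset \<open>T\<close> of \<open>S\<close>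
  containing them would separate \<open>v\<close> from the rest of \<open>S\<close>.\<close>

lemma three_attachments:
  assumes "three_connected V E" "S \<subseteq> V" "card S \<ge> 3" "v \<in> V - S"
  shows "card (attachments E S v) \<ge> 3"
proof (rule ccontr)
  let ?F = "{e\<in>E. e \<inter> S = {}}"
  assume "\<not> ?thesis"
  then have c: "card (attachments E S v) \<le> 2" by simp
  have fin: "finite S" using assms(3) by (metis card.infinite not_numeral_le_zero)
  have "attachments E S v \<subseteq> S" by (auto simp: attachments_def)
  then obtain T where T: "attachments E S v \<subseteq> T" "T \<subseteq> S" "card T = 2"
    using exists_subset_between[of "attachments E S v" 2 S] c assms(3) fin by auto
  then obtain s where s: "s \<in> S" "s \<notin> T"
    using assms(3) by (metis Suc_n_not_le_n numeral_2_eq_2 numeral_3_eq_3 subsetI subset_antisym)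
  have "connected_graph (V - T) {e\<in>E. e \<inter> T = {}}"
    using assms T by (auto simp: three_connected_def)
  then have "(v, s) \<in> (adj_rel {e\<in>E. e \<inter> T = {}})\<^sup>*"
    using assms s T unfolding connected_graph_def by blast
  \<comment> \<open>Invariant along the walk avoiding \<open>T\<close>: it stays in the component of
    \<open>v\<close> outside \<open>S\<close>, since entering \<open>S\<close> would give an
    attachment outside \<open>T\<close>. At \<open>s\<close> this is absurd.\<close>
  then have "(v, s) \<in> (adj_rel ?F)\<^sup>* \<and> s \<notin> S"
  proof (induction rule: rtrancl_induct)
    case base
    then show ?case using assms by simp
  next
    case (step y z)
    have yz: "{y, z} \<in> E" "z \<notin> T" using step(2) by (auto simp: adj_rel_def)
    have "z \<notin> S"
    proof
      assume "z \<in> S"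
      then have "z \<in> attachments E S v"
        using step(3) yz by (auto simp: attachments_def insert_commute)
      then show False using T yz by blast
    qed
    moreover have "(y, z) \<in> adj_rel ?F"
      using yz step(3) \<open>z \<notin> S\<close> by (auto simp: adj_rel_def)
    ultimately show ?case using step(3) by (auto intro: rtrancl_into_rtrancl)
  qed
  then show False using s by simp
qed

lemma reachable_avoids:
  assumes "(v, k) \<in> (adj_rel {e\<in>E. e \<inter> S = {}})\<^sup>*" "v \<notin> S"
  shows "k \<notin> S"
  using assms by (induction rule: rtrancl_induct) (auto simp: adj_rel_def)

text \<open>Join neighbours \<open>k\<close> of \<open>s\<close> and \<open>l\<close> of
  \<open>t\<close> inside the component of \<open>v\<close>. The interior contains \<open>k\<close>,
  so the path is new even if \<open>s\<close> and \<open>t\<close> are adjacent.\<close>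

lemma attachment_path:
  assumes "s \<in> attachments E S v" "t \<in> attachments E S v" "s \<noteq> t" "v \<notin> S"
  obtains R where "R \<noteq> []" "distinct (s # R @ [t])" "walk E (s # R @ [t])" "set R \<inter> S = {}"
    "\<forall>r\<in>set R. (v, r) \<in> (adj_rel {e\<in>E. e \<inter> S = {}})\<^sup>*"
proof -
  let ?F = "{e\<in>E. e \<inter> S = {}}"
  obtain k l where k: "(v, k) \<in> (adj_rel ?F)\<^sup>*" "{s, k} \<in> E"
    and l: "(v, l) \<in> (adj_rel ?F)\<^sup>*" "{t, l} \<in> E" and st: "s \<in> S" "t \<in> S"
    using assms by (auto simp: attachments_def)
  have "(k, l) \<in> (adj_rel ?F)\<^sup>*" using k(1) l(1) by (meson adj_rtrancl_sym rtrancl_trans)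
  then obtain R where R: "R \<noteq> []" "hd R = k" "last R = l" "distinct R" "walk ?F R"
    by (rule simple_walk)
  then obtain R' where R': "R = k # R'" by (cases R) auto
  have reach: "\<forall>r\<in>set R. (v, r) \<in> (adj_rel ?F)\<^sup>*"
    using walk_rtrancl[OF R(5)[unfolded R']] k(1) unfolding R' by (meson rtrancl_trans)
  then have dis: "set R \<inter> S = {}" using reachable_avoids[OF _ assms(4)] by blast
  have "walk E R" using R(5) by (rule walk_mono) auto
  then have "walk E (s # R @ [t])" using R k l
    by (auto simp: successively_append_iff successively_Cons insert_commute)
  moreover have "distinct (s # R @ [t])" using R(4) dis st assms(3) by auto
  ultimately show thesis using that[OF R(1) _ _ dis reach] by blast
qed

text \<open>Disjointness of rearranged paths becomes a multiset inclusion, which simplification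
  decides.\<close>

lemma distinct_submset: "mset xs \<subseteq># mset ys \<Longrightarrow> distinct ys \<Longrightarrow> distinct xs"
  by (metis distinct_append ex_mset mset_append mset_eq_imp_distinct_iff subset_mset.le_iff_add)

section \<open>Subdivisions of the complete graph on four vertices\<close>

text \<open>The lists \<open>p1\<close>, ..., \<open>p6\<close> are the interiors of the paths joining the branch vertices, in the
  order \<open>ab\<close>, \<open>ac\<close>, \<open>ad\<close>, \<open>bc\<close>, \<open>bd\<close>, \<open>cd\<close>; disjointness is then distinctness of one list.\<close>
definition K4sub where
  "K4sub E a b c d p1 p2 p3 p4 p5 p6 \<longleftrightarrow>
     distinct ([a, b, c, d] @ p1 @ p2 @ p3 @ p4 @ p5 @ p6) \<and>
     walk E (a # p1 @ [b]) \<and> walk E (a # p2 @ [c]) \<and> walk E (a # p3 @ [d]) \<and>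
     walk E (b # p4 @ [c]) \<and> walk E (b # p5 @ [d]) \<and> walk E (c # p6 @ [d])"

lemma walk_flip: "walk E (b # rev p @ [a]) = walk E (a # p @ [b])"
  using walk_rev[of E "a # p @ [b]"] by simp

text \<open>The three adjacent transpositions generate all relabellings of the branch vertices. Only
  the path between the exchanged vertices changes direction.\<close>

lemma K4sub_swap12:
  assumes "K4sub E a b c d p1 p2 p3 p4 p5 p6"
  shows "K4sub E b a c d (rev p1) p4 p5 p2 p3 p6"
proof -
  have "distinct ([b, a, c, d] @ rev p1 @ p4 @ p5 @ p2 @ p3 @ p6)"
    by (rule distinct_submset[OF _ assms[unfolded K4sub_def, THEN conjunct1]]) simp
  then show ?thesis using assms unfolding K4sub_def walk_flip by blast
qed

lemma K4sub_swap23: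
  assumes "K4sub E a b c d p1 p2 p3 p4 p5 p6"
  shows "K4sub E a c b d p2 p1 p3 (rev p4) p6 p5"
proof -
  have "distinct ([a, c, b, d] @ p2 @ p1 @ p3 @ rev p4 @ p6 @ p5)"
    by (rule distinct_submset[OF _ assms[unfolded K4sub_def, THEN conjunct1]]) simp
  then show ?thesis using assms unfolding K4sub_def walk_flip by blast
qed

lemma K4sub_swap34:
  assumes "K4sub E a b c d p1 p2 p3 p4 p5 p6"
  shows "K4sub E a b d c p1 p3 p2 p5 p4 (rev p6)"
proof -
  have "distinct ([a, b, d, c] @ p1 @ p3 @ p2 @ p5 @ p4 @ rev p6)"
    by (rule distinct_submset[OF _ assms[unfolded K4sub_def, THEN conjunct1]]) simp
  then show ?thesis using assms unfolding K4sub_def walk_flip by blast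
qed

section \<open>A subdivided K_4 in every 3-connected graph\<close>

lemma split_three:
  assumes "N \<subseteq> set xs" "card N \<ge> 3"
  obtains as x bs y cs z ds where "xs = as @ x # bs @ y # cs @ z # ds" "x \<in> N" "y \<in> N" "z \<in> N"
proof -
  \<comment> \<open>Split at the first element of \<open>M\<close>; the others then lie in the tail,
    so this can be applied three times.\<close>
  have split: "\<exists>as x ys. xs = as @ x # ys \<and> x \<in> M \<and> M - {x} \<subseteq> set ys \<and> card (M - {x}) \<ge> n"
    if "M \<subseteq> set xs" "card M \<ge> Suc n" for M n and xs :: "'a list"
  proof -
    have "M \<noteq> {}" using that(2) by (cases "M = {}") simp_all
    then have "\<exists>x\<in>set xs. x \<in> M" using that(1) by blast
    then obtain as x ys where *: "xs = as @ x # ys" "x \<in> M" "\<forall>a\<in>set as. a \<notin> M"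
      by (rule split_list_first_propE)
    have "finite M" using that finite_subset by blast
    then show ?thesis using * that by (intro exI[of _ as] exI[of _ x] exI[of _ ys]) auto
  qed
  obtain as x ys where 1: "xs = as @ x # ys" "x \<in> N" "N - {x} \<subseteq> set ys" "card (N - {x}) \<ge> 2"
    using split[of N xs 2] assms by auto
  obtain bs y zs where 2: "ys = bs @ y # zs" "y \<in> N - {x}" "N - {x} - {y} \<subseteq> set zs"
    "card (N - {x} - {y}) \<ge> 1"
    using split[of "N - {x}" ys 1] 1 by (auto simp: numeral_2_eq_2)
  obtain cs z ds where 3: "zs = cs @ z # ds" "z \<in> N - {x} - {y}"
    using split[of "N - {x} - {y}" zs 0] 2 by auto
  show thesis by (rule that[of as x bs y cs z ds]) (use 1(1,2) 2(1,2) 3 in simp_all)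
qed

text \<open>A vertex \<open>w\<close> other than \<open>u\<close> has two neighbours other than
  \<open>u\<close>. Deleting \<open>u\<close> and \<open>w\<close> leaves a path between them, which
  \<open>w\<close> closes to a cycle; appending \<open>hd C\<close> records the closing
  edge.\<close>

lemma avoiding_cycle:
  assumes J: "three_connected V E" and u: "u \<in> V"
  obtains C where "distinct C" "length C \<ge> 3" "walk E (C @ [hd C])" "set C \<subseteq> V" "u \<notin> set C"
proof -
  note g = three_connectedD(2)[OF J] graph_edge[OF three_connectedD(1)[OF J]] three_connectedD(3)[OF J]
  have "card (V - {u}) \<ge> 3" using g(1,3) u by simp
  then have "V - {u} \<noteq> {}" by (metis card.empty not_numeral_le_zero)
  then obtain w where w: "w \<in> V" "w \<noteq> u" by auto
  \<comment> \<open>With all vertices but \<open>w\<close> in the set, the component of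
    \<open>w\<close> is \<open>w\<close> alone, so \<open>N\<close> consists of its
    neighbours.\<close>
  define N where "N = attachments E (V - {w}) w"
  have N3: "card N \<ge> 3" unfolding N_def
    by (rule three_attachments[OF J]) (use g(1,3) w in auto)
  have N: "{s, w} \<in> E" if sN: "s \<in> N" for s
  proof -
    obtain k where k: "(w, k) \<in> (adj_rel {e\<in>E. e \<inter> (V - {w}) = {}})\<^sup>*" "{s, k} \<in> E"
      using sN by (auto simp: N_def attachments_def)
    have "k \<notin> V - {w}" using reachable_avoids[OF k(1)] by simp
    then have "k = w" using g(2)[OF k(2)] by simp
    with k show ?thesis by simp
  qed
  have finN: "finite N" using N g(1,2) finite_subset[of N V] by blast
  have "card (N - {u}) \<ge> 2" using N3 finN by (cases "u \<in> N") auto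
  then obtain s t where st: "s \<in> N - {u}" "t \<in> N - {u}" "s \<noteq> t"
    using card_le_Suc0_iff_eq[of "N - {u}"] finN
    by (metis Suc_1 finite_Diff not_less_eq_eq numeral_2_eq_2)
  let ?F = "{e\<in>E. e \<inter> {u, w} = {}}"
  have sw: "{s, w} \<in> E" "{t, w} \<in> E" using N st by auto
  have V: "s \<in> V - {u, w}" "t \<in> V - {u, w}" using g(2)[OF sw(1)] g(2)[OF sw(2)] st by auto
  have "connected_graph (V - {u, w}) ?F"
    using three_connectedD(4)[OF J u] w by blast
  then have "(s, t) \<in> (adj_rel ?F)\<^sup>*" using V by (auto simp: connected_graph_def)
  then obtain R where R: "distinct (s # R @ [t])" "walk ?F (s # R @ [t])"
    using st(3) by (rule link_ends)
  have wE: "walk E (s # R @ [t])" using R(2) by (rule walk_mono) auto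
  have in_edge: "\<forall>r\<in>set (s # R @ [t]). \<exists>e\<in>?F. r \<in> e"
    using walk_in_edge[OF R(2)] by auto
  have sub: "set (s # R @ [t]) \<subseteq> V - {u, w}"
  proof
    fix r assume "r \<in> set (s # R @ [t])"
    then obtain e where "e \<in> ?F" "r \<in> e" using in_edge by blast
    then show "r \<in> V - {u, w}" using three_connectedD(1)[OF J] unfolding graph_def by blast
  qed
  show thesis
    by (rule that[of "w # s # R @ [t]"])
       (use R(1) wE sub sw w in \<open>auto simp: successively_append_iff successively_Cons hd_append
          insert_commute split: if_splits\<close>)
qed

text \<open>The component of \<open>u\<close> off the cycle \<open>C\<close> has three attachments
  \<open>x\<close>, \<open>y\<close>, \<open>z\<close>. A path \<open>R\<close> through it joins
  \<open>x\<close> to \<open>y\<close>, and a path \<open>T\<close> joins \<open>z\<close> to some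
  \<open>w\<close> on \<open>R\<close>; this tripod centred at \<open>w\<close> and the cycle form
  the subdivision.\<close>

lemma three_connected_K4sub:
  assumes J: "three_connected V E"
  shows "\<exists>a b c d p1 p2 p3 p4 p5 p6. K4sub E a b c d p1 p2 p3 p4 p5 p6"
proof -
  have "V \<noteq> {}" using three_connectedD(3)[OF J] by auto
  then obtain u where u: "u \<in> V" by auto
  obtain C where C: "distinct C" "length C \<ge> 3" "walk E (C @ [hd C])" "set C \<subseteq> V" "u \<notin> set C"
    by (rule avoiding_cycle[OF J u])
  let ?S = "set C"
  let ?F = "{e\<in>E. e \<inter> ?S = {}}"
  define N where "N = attachments E ?S u"
  have N3: "card N \<ge> 3" unfolding N_def
    by (rule three_attachments[OF J]) (use C u in \<open>auto simp: distinct_card\<close>)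
  have "N \<subseteq> set C" by (auto simp: N_def attachments_def)
  then obtain as x bs y cs z ds where split: "C = as @ x # bs @ y # cs @ z # ds"
    and N: "x \<in> N" "y \<in> N" "z \<in> N" using N3 by (rule split_three)
  have "x \<noteq> y" using C(1) split by auto
  then obtain R where R: "R \<noteq> []" "distinct (x # R @ [y])" "walk E (x # R @ [y])" "set R \<inter> ?S = {}"
    and reach: "\<forall>r\<in>set R. (u, r) \<in> (adj_rel ?F)\<^sup>*"
    using attachment_path[of x E ?S u y] N C(5) unfolding N_def by blast
  obtain k where k: "(u, k) \<in> (adj_rel ?F)\<^sup>*" "{z, k} \<in> E"
    using N(3) by (auto simp: N_def attachments_def)
  have kS: "k \<notin> ?S" using reachable_avoids[OF k(1) C(5)] .
  \<comment> \<open>Adding only the edge \<open>zk\<close> lets a path start at \<open>z\<close> and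
    forces the rest of it to stay off the cycle.\<close>
  let ?G = "insert {z, k} ?F"
  obtain r where r: "r \<in> set R" using R(1) by (cases R) auto
  have "(k, r) \<in> (adj_rel ?F)\<^sup>*" using k(1) reach r by (meson adj_rtrancl_sym rtrancl_trans)
  then have "(k, r) \<in> (adj_rel ?G)\<^sup>*" using rtrancl_mono[OF adj_rel_mono[of ?F ?G]] by blast
  moreover have "(z, k) \<in> adj_rel ?G" by (simp add: adj_rel_def)
  ultimately have zr: "(z, r) \<in> (adj_rel ?G)\<^sup>*" by (rule converse_rtrancl_into_rtrancl[rotated])
  have zS: "z \<in> ?S" using split by simp
  then have zR: "{z} \<inter> set R = {}" using R(4) by auto
  obtain z' T w where "z' \<in> {z}" and T0: "w \<in> set R" "distinct (z' # T @ [w])"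
    "walk ?G (z' # T @ [w])" "set T \<inter> ({z} \<union> set R) = {}"
    by (rule link[OF zr _ r zR]) simp_all
  then have T: "w \<in> set R" "distinct (z # T @ [w])" "walk ?G (z # T @ [w])"
    "set T \<inter> ({z} \<union> set R) = {}" by simp_all
  have TS: "set T \<inter> ?S = {}"
  proof -
    { fix t assume t: "t \<in> set T"
      then obtain e where "e \<in> ?G" "t \<in> e" using walk_in_edge[OF T(3), of t] by auto
      moreover have "t \<noteq> z" using t T(4) by auto
      ultimately have "t \<notin> ?S" using kS by auto }
    then show ?thesis by auto
  qed
  have wT: "walk E (z # T @ [w])" using T(3) by (rule walk_mono) (use k in auto)
  obtain R1 R2 where RR: "R = R1 @ w # R2" using T(1) by (auto dest: split_list)
  \<comment> \<open>The third arc of the cycle runs through the end of the list \<open>C\<close>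
    back to its start, hence \<open>ds @ as\<close>.\<close>
  have zx: "walk E (z # (ds @ as) @ [x])"
    using C(3) unfolding split by (cases as) (simp_all add: walk_split)
  have cyc: "walk E (x # bs @ [y])" "walk E (y # cs @ [z])"
    using C(3) unfolding split by (simp_all add: walk_split)
  have RR': "walk E (x # R1 @ [w])" "walk E (w # R2 @ [y])"
    using R(3) unfolding RR by (simp_all add: walk_split)
  have "distinct ([x, y, z, w] @ bs @ rev (ds @ as) @ R1 @ cs @ rev R2 @ T)"
  proof -
    have "distinct (C @ R @ T)" using C(1) R(2,4) T(2,4) TS by auto
    then show ?thesis
      by (rule distinct_submset[rotated]) (simp add: split RR)
  qed
  then have "K4sub E x y z w bs (rev (ds @ as)) R1 cs (rev R2) T"
    unfolding K4sub_def walk_flip using cyc RR' zx wT by blast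
  then show ?thesis by blast
qed

section \<open>Degenerate subdivisions in a 3-connected graph\<close>

text \<open>With \<open>D\<close> the set of unsubdivided edges, these are the paths that remain
  single edges in \<open>H\<close>.\<close>

definition direct :: "'a set set \<Rightarrow> 'a \<Rightarrow> 'a \<Rightarrow> 'a list \<Rightarrow> bool" where
  "direct D a b p \<longleftrightarrow> p = [] \<and> {a, b} \<in> D"

lemma direct_rev [simp]: "direct D b a (rev p) = direct D a b p"
  by (simp add: direct_def insert_commute)

text \<open>Two non-direct paths at a common branch vertex: this is equivalent to the branch vertices not
  lying on a 4-cycle of direct paths, since the edges outside a Hamilton cycle of \<open>K\<^sub>4\<close> form a
  perfect matching.\<close>
definition good_K4 :: "'a set set \<Rightarrow> 'a set set \<Rightarrow> bool" where
  "good_K4 E D \<longleftrightarrow> (\<exists>a b c d p1 p2 p3 p4 p5 p6. K4sub E a b c d p1 p2 p3 p4 p5 p6 \<and>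
     \<not> direct D a b p1 \<and> \<not> direct D a c p2)"

text \<open>\<open>P\<close> and \<open>Q\<close> are the diagonals of the direct 4-cycle
  \<open>abcd\<close>.\<close>

definition degenerate_K4 ::
  "'a set set \<Rightarrow> 'a set set \<Rightarrow> 'a \<Rightarrow> 'a \<Rightarrow> 'a \<Rightarrow> 'a \<Rightarrow> 'a list \<Rightarrow> 'a list \<Rightarrow> bool" where
  "degenerate_K4 E D a b c d P Q \<longleftrightarrow> distinct ([a, b, c, d] @ P @ Q) \<and>
     walk E (a # P @ [c]) \<and> walk E (b # Q @ [d]) \<and>
     {a, b} \<in> D \<and> {b, c} \<in> D \<and> {c, d} \<in> D \<and> {a, d} \<in> D"

text \<open>Rotation and reflection give all symmetries of the 4-cycle; rotation exchanges the two
  diagonals.\<close>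

lemma degenerate_K4_rotate:
  assumes "degenerate_K4 E D a b c d P Q"
  shows "degenerate_K4 E D b c d a Q (rev P)"
proof -
  have "distinct ([b, c, d, a] @ Q @ rev P)"
    by (rule distinct_submset[OF _ assms[unfolded degenerate_K4_def, THEN conjunct1]]) simp
  then show ?thesis
    using assms unfolding degenerate_K4_def walk_flip by (simp add: insert_commute)
qed

lemma degenerate_K4_reflect:
  assumes "degenerate_K4 E D a b c d P Q"
  shows "degenerate_K4 E D a d c b P (rev Q)"
proof -
  have "distinct ([a, d, c, b] @ P @ rev Q)"
    by (rule distinct_submset[OF _ assms[unfolded degenerate_K4_def, THEN conjunct1]]) simp
  then show ?thesis
    using assms unfolding degenerate_K4_def walk_flip by (simp add: insert_commute)
qed

text \<open>\<open>good_K4\<close> names one pair of paths at \<open>a\<close>; relabelling the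
  other branch vertices reaches the remaining pairs.\<close>

lemma not_good_corner:
  assumes K: "K4sub E a b c d p1 p2 p3 p4 p5 p6" and "\<not> good_K4 E D"
  shows "direct D a b p1 \<or> direct D a c p2" "direct D a b p1 \<or> direct D a d p3"
    "direct D a c p2 \<or> direct D a d p3"
proof -
  show "direct D a b p1 \<or> direct D a c p2" using assms unfolding good_K4_def by blast
  show "direct D a b p1 \<or> direct D a d p3"
    using K4sub_swap34[OF K] assms(2) unfolding good_K4_def by blast
  show "direct D a c p2 \<or> direct D a d p3"
    using K4sub_swap34[OF K4sub_swap23[OF K]] assms(2) unfolding good_K4_def by blast
qed

lemma not_good_K4sub:
  assumes K: "K4sub E a b c d p1 p2 p3 p4 p5 p6" and n: "\<not> good_K4 E D"
  shows "direct D a b p1 \<or> direct D a c p2" "direct D a b p1 \<or> direct D a d p3"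
    "direct D a c p2 \<or> direct D a d p3"
    "direct D a b p1 \<or> direct D b c p4" "direct D a b p1 \<or> direct D b d p5"
    "direct D b c p4 \<or> direct D b d p5"
    "direct D a c p2 \<or> direct D b c p4" "direct D a c p2 \<or> direct D c d p6"
    "direct D b c p4 \<or> direct D c d p6"
    "direct D a d p3 \<or> direct D b d p5" "direct D a d p3 \<or> direct D c d p6"
    "direct D b d p5 \<or> direct D c d p6"
  using not_good_corner[OF K n] not_good_corner[OF K4sub_swap12[OF K] n]
    not_good_corner[OF K4sub_swap12[OF K4sub_swap23[OF K]] n]
    not_good_corner[OF K4sub_swap12[OF K4sub_swap23[OF K4sub_swap34[OF K]]] n]
  by simp_all

text \<open>No two non-direct paths share an end, so they lie in a perfect matching of K_4, and the
  complement of that matching is a direct 4-cycle.\<close>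

lemma not_good_degenerate:
  assumes K: "K4sub E a b c d p1 p2 p3 p4 p5 p6" and n: "\<not> good_K4 E D"
  shows "\<exists>a b c d P Q. degenerate_K4 E D a b c d P Q"
proof -
  note pairs = not_good_K4sub[OF K n]
  have degI: "degenerate_K4 E D a b c d p2 p5"
    if "K4sub E a b c d p1 p2 p3 p4 p5 p6"
      "direct D a b p1" "direct D b c p4" "direct D c d p6" "direct D a d p3"
    for a b c d p1 p2 p3 p4 p5 p6
    using that unfolding K4sub_def degenerate_K4_def direct_def by simp
  \<comment> \<open>One case for each perfect matching: \<open>ac\<close>, \<open>bd\<close>; then
    \<open>ab\<close>, \<open>cd\<close>; then \<open>ad\<close>, \<open>bc\<close>.\<close>
  consider "direct D a b p1" "direct D b c p4" "direct D c d p6" "direct D a d p3"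
    | "direct D a c p2" "direct D b c p4" "direct D b d p5" "direct D a d p3"
    | "direct D a b p1" "direct D b d p5" "direct D c d p6" "direct D a c p2"
    using pairs by blast
  then show ?thesis
  proof cases
    case 1
    then show ?thesis using degI[OF K] by blast
  next
    case 2
    then have "degenerate_K4 E D a c b d p1 p6"
      using degI[OF K4sub_swap23[OF K]] by (simp add: direct_def insert_commute)
    then show ?thesis by blast
  next
    case 3
    then have "degenerate_K4 E D a b d c p3 p4"
      using degI[OF K4sub_swap34[OF K]] by (simp add: direct_def insert_commute)
    then show ?thesis by blast
  qed
qed

lemma card_3_obtain:
  assumes "card X = 3" "p \<in> X"
  obtains q r where "X = {p, q, r}" "p \<noteq> q" "p \<noteq> r" "q \<noteq> r"
proof -
  have "card (X - {p}) = 2" using assms by (simp add: card_Diff_singleton)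
  then obtain q r where *: "X - {p} = {q, r}" "q \<noteq> r" by (auto simp: card_2_iff)
  then have "X = {p, q, r}" using assms(2) by blast
  with * show thesis using that[of q r] by blast
qed

text \<open>\<open>D\<close> is the set of edges of the 3-connected graph that are not subdivided in \<open>H\<close>;
  bipartiteness of \<open>H\<close> survives only for these edges.\<close>
locale marked_graph =
  fixes V :: "'a set" and E D :: "'a set set" and A :: "'a set"
  assumes J: "three_connected V E" and DE: "D \<subseteq> E"
    and sides: "{u, v} \<in> D \<Longrightarrow> u \<in> A \<longleftrightarrow> v \<notin> A"
begin

text \<open>The form in which bipartiteness is used: vertices with a common direct neighbour are
  never joined by a direct path.\<close>

lemma no_triangle: "{u, v} \<in> D \<Longrightarrow> {v, w} \<in> D \<Longrightarrow> {u, w} \<notin> D"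
  using sides by blast

lemma edge_V: "{u, v} \<in> E \<Longrightarrow> u \<in> V \<and> v \<in> V \<and> u \<noteq> v"
  by (rule graph_edge[OF three_connectedD(1)[OF J]])

lemma walk_V:
  assumes "walk E xs" "length xs \<ge> 2"
  shows "set xs \<subseteq> V"
proof
  fix t assume "t \<in> set xs"
  then obtain e where "e \<in> E" "t \<in> e" using walk_in_edge assms by metis
  then show "t \<in> V" using three_connectedD(1)[OF J] unfolding graph_def by blast
qed

text \<open>Delete the edge \<open>ab\<close>; \<open>d\<close> is then incident with \<open>Q\<close> and with the path through \<open>a\<close> to \<open>x\<close>.\<close>
lemma spoke_good:
  assumes K: "degenerate_K4 E D a b c d (P1 @ x # P2) Q"
    and R: "walk E (x # R @ [b])" "distinct R" "set R \<inter> set ([a, b, c, d] @ (P1 @ x # P2) @ Q) = {}"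
  shows "good_K4 E D"
proof -
  let ?all = "[a, b, c, d] @ (P1 @ x # P2) @ Q"
  have dis: "distinct ?all" and D: "{a, b} \<in> D" "{b, c} \<in> D" "{c, d} \<in> D" "{a, d} \<in> D"
    and w: "walk E (a # P1 @ [x])" "walk E (x # P2 @ [c])" "walk E (b # Q @ [d])"
    using K unfolding degenerate_K4_def by (auto simp: walk_split)
  have "distinct (R @ ?all)" using R(2,3) dis unfolding distinct_append by blast
  then have "distinct ([d, b, x, c] @ rev Q @ (a # P1) @ [] @ rev R @ [] @ P2)"
    by (rule distinct_submset[rotated]) simp
  moreover have "{b, c} \<in> E" "{d, c} \<in> E" "{d, a} \<in> E"
    using D DE by (auto simp: insert_commute)
  ultimately have "K4sub E d b x c (rev Q) (a # P1) [] (rev R) [] P2"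
    unfolding K4sub_def walk_flip using R(1) w by simp
  moreover have "\<not> direct D d b (rev Q)"
    using no_triangle[OF D(2,3)] by (simp add: direct_def insert_commute)
  moreover have "\<not> direct D d x (a # P1)" by (simp add: direct_def)
  ultimately show ?thesis unfolding good_K4_def by blast
qed

text \<open>Delete the edge \<open>ab\<close> of the subdivided \<open>K\<^sub>3\<^sub>,\<^sub>3\<close> with sides \<open>{a, c, y}\<close> and \<open>{b, d, x}\<close>.\<close>
lemma cross_direct:
  assumes n: "\<not> good_K4 E D" and K: "degenerate_K4 E D a b c d (P1 @ x # P2) (Q1 @ y # Q2)"
    and R: "walk E (x # R @ [y])" "distinct R"
      "set R \<inter> set ([a, b, c, d] @ (P1 @ x # P2) @ (Q1 @ y # Q2)) = {}"
  shows "{c, x} \<in> D" "{d, y} \<in> D" "{x, y} \<in> D"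
proof -
  let ?all = "[a, b, c, d] @ (P1 @ x # P2) @ (Q1 @ y # Q2)"
  have dis: "distinct ?all" and D: "{a, b} \<in> D" "{b, c} \<in> D" "{c, d} \<in> D" "{a, d} \<in> D"
    and w: "walk E (a # P1 @ [x])" "walk E (x # P2 @ [c])"
      "walk E (b # Q1 @ [y])" "walk E (y # Q2 @ [d])"
    using K unfolding degenerate_K4_def by (auto simp: walk_split)
  have "distinct (R @ ?all)" using R(2,3) dis unfolding distinct_append by blast
  then have "distinct ([c, d, x, y] @ [] @ rev P2 @ (b # Q1) @ (a # P1) @ rev Q2 @ R)"
    by (rule distinct_submset[rotated]) simp
  moreover have "{c, b} \<in> E" "{c, d} \<in> E" "{d, a} \<in> E"
    using D DE by (auto simp: insert_commute)
  ultimately have "K4sub E c d x y [] (rev P2) (b # Q1) (a # P1) (rev Q2) R"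
    unfolding K4sub_def walk_flip using R(1) w by simp
  \<comment> \<open>The paths \<open>c\<close> to \<open>y\<close> through \<open>b\<close> and
    \<open>d\<close> to \<open>x\<close> through \<open>a\<close> are not direct, and each of the
    three paths in question shares an end with one of them.\<close>
  from not_good_K4sub[OF this n] show "{c, x} \<in> D" "{d, y} \<in> D" "{x, y} \<in> D"
    by (simp_all add: direct_def)
qed

section \<open>Subgraphs K_{3,3} made of direct edges\<close>

definition K33_in :: "'a set \<Rightarrow> 'a set \<Rightarrow> bool" where
  "K33_in X Y \<longleftrightarrow> card X = 3 \<and> card Y = 3 \<and> X \<inter> Y = {} \<and> (\<forall>p\<in>X. \<forall>q\<in>Y. {p, q} \<in> D)"

lemma K33_in_commute: "K33_in X Y \<Longrightarrow> K33_in Y X"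
  unfolding K33_in_def by (metis insert_commute Int_commute)

text \<open>Branch vertices \<open>p1\<close>, \<open>p2\<close>, \<open>p3\<close>,
  \<open>q1\<close>: at \<open>p1\<close>, the path \<open>R\<close> to \<open>p2\<close> is not
  direct because of the common neighbour \<open>q1\<close>, and the path to \<open>p3\<close> runs
  through \<open>q2\<close>. \<open>R\<close> may be empty.\<close>

lemma K33_same_side:
  assumes K: "K33_in X Y" and p: "p1 \<in> X" "p2 \<in> X" "p1 \<noteq> p2"
    and R: "walk E (p1 # R @ [p2])" "distinct R" "set R \<inter> (X \<union> Y) = {}"
  shows "good_K4 E D"
proof -
  obtain p3 where X: "X = {p1, p2, p3}" and p3: "p1 \<noteq> p3" "p2 \<noteq> p3"
  proof -
    obtain q r where "X = {p1, q, r}" "p1 \<noteq> q" "p1 \<noteq> r" "q \<noteq> r"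
      using card_3_obtain[of X p1] K p unfolding K33_in_def by metis
    with p show thesis using that[of q] that[of r] by (auto simp: insert_commute)
  qed
  have "Y \<noteq> {}" using K unfolding K33_in_def by auto
  then obtain q1 where "q1 \<in> Y" by blast
  then obtain q2 q3 where Y: "Y = {q1, q2, q3}" "q1 \<noteq> q2" "q1 \<noteq> q3" "q2 \<noteq> q3"
    using card_3_obtain[of Y q1] K unfolding K33_in_def by metis
  have D: "{p, q} \<in> D" "{q, p} \<in> D" if "p \<in> X" "q \<in> Y" for p q
    using K that unfolding K33_in_def by (simp_all add: insert_commute)
  have E: "{p, q} \<in> E" "{q, p} \<in> E" if "p \<in> X" "q \<in> Y" for p q
    using D[OF that] DE by blast+
  have "X \<inter> Y = {}" using K unfolding K33_in_def by blast
  then have "distinct ([p1, p2, p3, q1] @ R @ [q2] @ [] @ [q3] @ [] @ [])"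
    using p(3) p3 Y R(2,3) unfolding X Y(1) by auto
  then have "K4sub E p1 p2 p3 q1 R [q2] [] [q3] [] []"
    unfolding K4sub_def using R(1) by (simp add: E X Y(1))
  moreover have "\<not> direct D p1 p2 R"
    using no_triangle[OF D(1)[of p1 q1] D(2)[of p2 q1]] by (simp add: X Y(1) direct_def)
  moreover have "\<not> direct D p1 p3 [q2]" by (simp add: direct_def)
  ultimately show ?thesis unfolding good_K4_def by blast
qed

text \<open>\<open>R\<close> replaces the edge \<open>p1 q1\<close>. Branch vertices
  \<open>p1\<close>, \<open>q1\<close>, \<open>p3\<close>, \<open>q3\<close>: at \<open>p1\<close>,
  both \<open>R\<close> and the path through \<open>q2\<close> to \<open>p3\<close> have interior
  vertices.\<close>

lemma K33_other_side:
  assumes K: "K33_in X Y" and p: "p1 \<in> X" "q1 \<in> Y" "R \<noteq> []"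
    and R: "walk E (p1 # R @ [q1])" "distinct R" "set R \<inter> (X \<union> Y) = {}"
  shows "good_K4 E D"
proof -
  obtain p2 p3 where X: "X = {p1, p2, p3}" "p1 \<noteq> p2" "p1 \<noteq> p3" "p2 \<noteq> p3"
    using card_3_obtain[of X p1] K p unfolding K33_in_def by metis
  obtain q2 q3 where Y: "Y = {q1, q2, q3}" "q1 \<noteq> q2" "q1 \<noteq> q3" "q2 \<noteq> q3"
    using card_3_obtain[of Y q1] K p unfolding K33_in_def by metis
  have E: "{p, q} \<in> E" "{q, p} \<in> E" if "p \<in> X" "q \<in> Y" for p q
    using K that DE unfolding K33_in_def by (auto simp: insert_commute)
  have "X \<inter> Y = {}" using K unfolding K33_in_def by blast
  then have "distinct ([p1, q1, p3, q3] @ R @ [q2] @ [] @ [] @ [p2] @ [])"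
    using X(2-) Y(2-) R(2,3) unfolding X(1) Y(1) by auto
  then have "K4sub E p1 q1 p3 q3 R [q2] [] [] [p2] []"
    unfolding K4sub_def using R(1) by (simp add: E X(1) Y(1))
  moreover have "\<not> direct D p1 q1 R" using p(3) by (simp add: direct_def)
  moreover have "\<not> direct D p1 p3 [q2]" by (simp add: direct_def)
  ultimately show ?thesis unfolding good_K4_def by blast
qed

text \<open>A further vertex gives a path through its component between two attachments, and an edge
  inside a side is such a path with empty interior; both give a good K_4. So all edges cross, and
  crossing edges are in \<open>D\<close>.\<close>

lemma K33_spans:
  assumes K: "K33_in X Y" and n: "\<not> good_K4 E D"
  shows "V = X \<union> Y" "E = D" "E = {{p, q} | p q. p \<in> X \<and> q \<in> Y}"
proof -
  note K' = K33_in_commute[OF K]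
  have D: "{p, q} \<in> D" if "p \<in> X" "q \<in> Y" for p q
    using K that unfolding K33_in_def by blast
  have ne: "X \<noteq> {}" "Y \<noteq> {}" and disj: "X \<inter> Y = {}" and c3: "card X = 3" "card Y = 3"
    using K unfolding K33_in_def by auto
  have sub: "X \<union> Y \<subseteq> V" using D DE edge_V ne by blast
  have fin: "finite X" "finite Y" using c3 by (simp_all add: card_ge_0_finite)
  show V: "V = X \<union> Y"
  proof (rule ccontr)
    assume "V \<noteq> X \<union> Y"
    then obtain v where v: "v \<in> V - (X \<union> Y)" using sub by blast
    have "card (X \<union> Y) \<ge> 3" using c3 fin disj by (simp add: card_Un_disjoint)
    then have "card (attachments E (X \<union> Y) v) \<ge> 3"
      using three_attachments[OF J sub _ v] by blast
    then have "\<not> card (attachments E (X \<union> Y) v) \<le> Suc 0" by simp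
    moreover have "finite (attachments E (X \<union> Y) v)" using fin by (simp add: attachments_def)
    ultimately obtain s t where st: "s \<in> attachments E (X \<union> Y) v"
      "t \<in> attachments E (X \<union> Y) v" "s \<noteq> t"
      using card_le_Suc0_iff_eq by metis
    then have st': "s \<in> X \<union> Y" "t \<in> X \<union> Y" by (simp_all add: attachments_def)
    have "v \<notin> X \<union> Y" using v by blast
    from st this obtain R where R: "R \<noteq> []" "distinct (s # R @ [t])" "walk E (s # R @ [t])"
      "set R \<inter> (X \<union> Y) = {}" by (rule attachment_path)
    have R': "distinct R" "set R \<inter> (Y \<union> X) = {}" using R(2,4) by auto
    consider "s \<in> X" "t \<in> X" | "s \<in> Y" "t \<in> Y" | "s \<in> X" "t \<in> Y" | "s \<in> Y" "t \<in> X"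
      using st' by blast
    then show False
    proof cases
      case 1
      show False using K33_same_side[OF K 1 st(3) R(3) R'(1) R(4)] n by blast
    next
      case 2
      show False using K33_same_side[OF K' 2 st(3) R(3) R'] n by blast
    next
      case 3
      show False using K33_other_side[OF K 3 R(1,3) R'(1) R(4)] n by blast
    next
      case 4
      show False using K33_other_side[OF K' 4 R(1,3) R'] n by blast
    qed
  qed
  show E: "E = {{p, q} | p q. p \<in> X \<and> q \<in> Y}"
  proof
    show "{{p, q} | p q. p \<in> X \<and> q \<in> Y} \<subseteq> E" using D DE by blast
    show "E \<subseteq> {{p, q} | p q. p \<in> X \<and> q \<in> Y}"
    proof
      fix e assume e: "e \<in> E"
      then have "card e = 2" using three_connectedD(1)[OF J] unfolding graph_def by blast
      then obtain u v where uv: "e = {u, v}" "u \<noteq> v" by (auto simp: card_2_iff)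
      have "u \<in> X \<union> Y" "v \<in> X \<union> Y" using edge_V e uv V by blast+
      moreover have w: "walk E (u # [] @ [v])" using e uv by simp
      have "\<not> (u \<in> X \<and> v \<in> X)" using K33_same_side[OF K _ _ uv(2) w] n by auto
      moreover have "\<not> (u \<in> Y \<and> v \<in> Y)" using K33_same_side[OF K' _ _ uv(2) w] n by auto
      ultimately show "e \<in> {{p, q} | p q. p \<in> X \<and> q \<in> Y}" using uv by blast
    qed
  qed
  show "E = D" using DE D unfolding E by blast
qed

text \<open>Without \<open>a\<close> and \<open>c\<close>, an inner vertex of \<open>P\<close> still
  reaches \<open>b\<close>. Take a path from \<open>P\<close> to the rest: ending at
  \<open>b\<close> or \<open>d\<close> it gives a good K_4, so it ends inside \<open>Q\<close>, and
  \<open>cross_direct\<close> makes all paths of the resulting K_{3,3} direct.\<close>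

lemma degenerate_K4_jump:
  assumes n: "\<not> good_K4 E D" and K: "degenerate_K4 E D a b c d P Q" and "P \<noteq> []"
  shows "\<exists>X Y. K33_in X Y"
proof -
  have dis: "distinct ([a, b, c, d] @ P @ Q)" and D: "{a, b} \<in> D" "{b, c} \<in> D" "{c, d} \<in> D" "{a, d} \<in> D"
    and w: "walk E (a # P @ [c])" "walk E (b # Q @ [d])"
    using K unfolding degenerate_K4_def by blast+
  let ?F = "{e\<in>E. e \<inter> {a, c} = {}}"
  obtain p where p: "p \<in> set P" using \<open>P \<noteq> []\<close> by (cases P) auto
  have "a \<in> V" "b \<in> V" "c \<in> V" using edge_V D DE by blast+
  moreover have "p \<in> V" using walk_V[OF w(1)] p by auto
  moreover have "p \<notin> {a, c}" "b \<notin> {a, c}" "a \<noteq> c" using dis p by auto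
  ultimately have "(p, b) \<in> (adj_rel ?F)\<^sup>*"
    using three_connectedD(4)[OF J] unfolding connected_graph_def by blast
  moreover have "b \<in> {b, d} \<union> set Q" "set P \<inter> ({b, d} \<union> set Q) = {}" using dis by auto
  ultimately obtain x R y where x: "x \<in> set P" and y: "y \<in> {b, d} \<union> set Q"
    and R: "distinct (x # R @ [y])" "walk ?F (x # R @ [y])"
      "set R \<inter> (set P \<union> ({b, d} \<union> set Q)) = {}"
    using p by (elim link)
  have wR: "walk E (x # R @ [y])" using R(2) by (rule walk_mono) auto
  \<comment> \<open>Each vertex of \<open>R\<close> lies on an edge that survives the deletion of
    \<open>a\<close> and \<open>c\<close>.\<close>
  have "set R \<inter> {a, c} = {}" using walk_in_edge[OF R(2)] by fastforce
  then have Rdis: "set R \<inter> set ([a, b, c, d] @ P @ Q) = {}" using R(3) by auto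
  have dR: "distinct R" using R(1) by simp
  obtain P1 P2 where P: "P = P1 @ x # P2" using x by (auto dest: split_list)
  have "y \<noteq> b"
    using spoke_good[OF K[unfolded P], of R] wR dR Rdis n unfolding P by blast
  moreover have "y \<noteq> d"
  proof
    assume "y = d"
    then show False
      using spoke_good[OF degenerate_K4_reflect[OF K, unfolded P], of R] wR dR Rdis n
      unfolding P by auto
  qed
  ultimately have "y \<in> set Q" using y by blast
  then obtain Q1 Q2 where Q: "Q = Q1 @ y # Q2" by (auto dest: split_list)
  have D1: "{c, x} \<in> D" "{d, y} \<in> D" "{x, y} \<in> D"
    using cross_direct[OF n K[unfolded P Q] wR dR Rdis[unfolded P Q]] by blast+
  \<comment> \<open>A half turn of the 4-cycle: the same argument then yields the two missing edges
    \<open>ax\<close> and \<open>by\<close>.\<close>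
  have K2: "degenerate_K4 E D c d a b (rev P2 @ x # rev P1) (rev Q2 @ y # rev Q1)"
    using degenerate_K4_rotate[OF degenerate_K4_rotate[OF K]] unfolding P Q by simp
  have "set R \<inter> set ([c, d, a, b] @ (rev P2 @ x # rev P1) @ (rev Q2 @ y # rev Q1)) = {}"
    using Rdis unfolding P Q by auto
  then have D2: "{a, x} \<in> D" "{b, y} \<in> D"
    using cross_direct[OF n K2 wR dR] by blast+
  have "distinct [a, b, c, d, x, y]"
    by (rule distinct_submset[OF _ dis]) (simp add: P Q)
  then have "K33_in {a, c, y} {b, d, x}"
    using D D1 D2 unfolding K33_in_def by (auto simp: insert_commute)
  then show ?thesis by blast
qed

text \<open>If both diagonals of a degenerate subdivision are edges, its branch vertices span a K_4.
  A further vertex then provides a diagonal with interior vertices, to which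
  \<open>degenerate_K4_jump\<close> applies.\<close>

lemma marked_graph_cases:
  assumes n: "\<not> good_K4 E D"
  shows "(card V = 4 \<and> E = {{u, v} | u v. u \<in> V \<and> v \<in> V \<and> u \<noteq> v}) \<or> (\<exists>X Y. K33_in X Y)"
proof -
  obtain a b c d P Q where K: "degenerate_K4 E D a b c d P Q"
    using three_connected_K4sub[OF J] not_good_degenerate n by metis
  consider "P \<noteq> []" | "Q \<noteq> []" | "P = []" "Q = []" by blast
  then show ?thesis
  proof cases
    case 1
    then show ?thesis using degenerate_K4_jump[OF n K] by blast
  next
    case 2
    then show ?thesis using degenerate_K4_jump[OF n degenerate_K4_rotate[OF K]] by blast
  next
    case 3
    have dis: "distinct [a, b, c, d]" and D: "{a, b} \<in> D" "{b, c} \<in> D" "{c, d} \<in> D" "{a, d} \<in> D"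
      and w: "{a, c} \<in> E" "{b, d} \<in> E"
      using K unfolding degenerate_K4_def 3 by auto
    let ?S = "{a, b, c, d}"
    have sub: "?S \<subseteq> V" using edge_V w by blast
    have c4: "card ?S = 4" using dis by simp
    show ?thesis
    proof (cases "V = ?S")
      case True
      have "E = {{u, v} | u v. u \<in> V \<and> v \<in> V \<and> u \<noteq> v}"
      proof
        show "E \<subseteq> {{u, v} | u v. u \<in> V \<and> v \<in> V \<and> u \<noteq> v}"
        proof
          fix e assume e: "e \<in> E"
          then have "card e = 2" using three_connectedD(1)[OF J] unfolding graph_def by blast
          then obtain u v where "e = {u, v}" by (auto simp: card_2_iff)
          then show "e \<in> {{u, v} | u v. u \<in> V \<and> v \<in> V \<and> u \<noteq> v}" using edge_V e by blast
        qed
        have "{a, b} \<in> E" "{b, c} \<in> E" "{c, d} \<in> E" "{a, d} \<in> E" using D DE by blast+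
        then show "{{u, v} | u v. u \<in> V \<and> v \<in> V \<and> u \<noteq> v} \<subseteq> E"
          using w unfolding True by (auto simp: insert_commute)
      qed
      then show ?thesis using c4 True by blast
    next
      case False
      then obtain v where v: "v \<in> V - ?S" using sub by blast
      let ?N = "attachments E ?S v"
      have N3: "card ?N \<ge> 3" using three_attachments[OF J sub _ v] c4 by simp
      have NS: "?N \<subseteq> ?S" by (auto simp: attachments_def)
      have "\<not> ?N \<subseteq> {s, t}" for s t
      proof
        assume "?N \<subseteq> {s, t}"
        then have "card ?N \<le> card {s, t}" by (intro card_mono) auto
        also have "\<dots> \<le> 2" by (simp add: card_insert_if)
        finally show False using N3 by simp
      qed
      \<comment> \<open>A set contained in no pair with one end from each diagonal contains both
        ends of some diagonal.\<close>
      then have "\<not> ?N \<subseteq> {a, b}" "\<not> ?N \<subseteq> {a, d}" "\<not> ?N \<subseteq> {c, b}" "\<not> ?N \<subseteq> {c, d}" by blast+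
      then consider "a \<in> ?N" "c \<in> ?N" | "b \<in> ?N" "d \<in> ?N" using NS by blast
      then show ?thesis
      proof cases
        case 1
        have "a \<noteq> c" "v \<notin> ?S" using dis v by auto
        with 1 obtain R where R: "R \<noteq> []" "distinct (a # R @ [c])" "walk E (a # R @ [c])"
          "set R \<inter> ?S = {}" by (rule attachment_path)
        have "degenerate_K4 E D a b c d R []"
          using dis D w R(2,3,4) unfolding degenerate_K4_def by auto
        then show ?thesis using degenerate_K4_jump[OF n] R(1) by blast
      next
        case 2
        have "b \<noteq> d" "v \<notin> ?S" using dis v by auto
        with 2 obtain R where R: "R \<noteq> []" "distinct (b # R @ [d])" "walk E (b # R @ [d])"
          "set R \<inter> ?S = {}" by (rule attachment_path)
        have "degenerate_K4 E D a b c d [] R"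
          using dis D w R(2,3,4) unfolding degenerate_K4_def by auto
        from degenerate_K4_rotate[OF this] show ?thesis
          using degenerate_K4_jump[OF n] R(1) by blast
      qed
    qed
  qed
qed

end

section \<open>Lifting to the subdivided graph\<close>

lemma is_path_iff: "is_path E xs \<longleftrightarrow> distinct xs \<and> length xs \<ge> 2 \<and> walk E xs"
  by (simp add: is_path_def successively_conv_nth)

lemma path_edges_simps [simp]:
  "path_edges [] = {}" "path_edges [x] = {}"
  "path_edges (x # y # xs) = insert {x, y} (path_edges (y # xs))"
proof -
  show "path_edges (x # y # xs) = insert {x, y} (path_edges (y # xs))"
  proof (rule set_eqI)
    fix e
    show "e \<in> path_edges (x # y # xs) \<longleftrightarrow> e \<in> insert {x, y} (path_edges (y # xs))"
    proof
      assume "e \<in> path_edges (x # y # xs)"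
      then obtain i where i: "Suc i < length (x # y # xs)"
        "e = {(x # y # xs) ! i, (x # y # xs) ! Suc i}" unfolding path_edges_def by blast
      then show "e \<in> insert {x, y} (path_edges (y # xs))"
        by (cases i) (auto simp: path_edges_def)
    next
      assume "e \<in> insert {x, y} (path_edges (y # xs))"
      then consider "e = {x, y}"
        | i where "Suc i < length (y # xs)" "e = {(y # xs) ! i, (y # xs) ! Suc i}"
        unfolding path_edges_def by blast
      then show "e \<in> path_edges (x # y # xs)"
      proof cases
        case 1
        then show ?thesis unfolding path_edges_def by (intro CollectI exI[of _ 0]) simp
      next
        case (2 i)
        then show ?thesis unfolding path_edges_def by (intro CollectI exI[of _ "Suc i"]) simp
      qed
    qed
  qed
qed (simp_all add: path_edges_def)

lemma path_edges_walk: "walk E xs \<longleftrightarrow> path_edges xs \<subseteq> E"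
  by (induction xs rule: induct_list012) auto

lemma path_edges_subset: "f \<in> path_edges xs \<Longrightarrow> f \<subseteq> set xs"
  by (induction xs rule: induct_list012) auto

lemma path_edges_card: "distinct xs \<Longrightarrow> f \<in> path_edges xs \<Longrightarrow> card f = 2"
  by (induction xs rule: induct_list012) auto

lemma finite_path_edges: "finite (path_edges xs)"
  by (induction xs rule: induct_list012) auto

lemma Union_path_edges: "length xs \<ge> 2 \<Longrightarrow> \<Union> (path_edges xs) = set xs"
proof (induction xs rule: induct_list012)
  case (3 x y zs)
  then show ?case by (cases zs) auto
qed auto

lemma card_path_edges_at:
  assumes "distinct xs"
  shows "card {f \<in> path_edges xs. v \<in> f} \<le> 2"
proof (cases "v \<in> set xs")
  case True
  then obtain i where i: "i < length xs" "v = xs ! i" by (auto simp: in_set_conv_nth)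
  \<comment> \<open>At the ends one of the two sets is no edge: \<open>i - 1\<close> truncates to 0,
    or \<open>Suc i\<close> is out of range. For an upper bound this is harmless.\<close>
  have "{f \<in> path_edges xs. v \<in> f} \<subseteq> {{xs ! i, xs ! Suc i}, {xs ! (i - 1), xs ! i}}"
  proof
    fix f assume "f \<in> {f \<in> path_edges xs. v \<in> f}"
    then obtain j where j: "Suc j < length xs" "f = {xs ! j, xs ! Suc j}" "v \<in> f"
      unfolding path_edges_def by blast
    then have "i = j \<or> i = Suc j" using i assms by (auto simp: nth_eq_iff_index_eq)
    then show "f \<in> {{xs ! i, xs ! Suc i}, {xs ! (i - 1), xs ! i}}" using j by auto
  qed
  then have "card {f \<in> path_edges xs. v \<in> f} \<le> card {{xs ! i, xs ! Suc i}, {xs ! (i - 1), xs ! i}}"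
    by (intro card_mono) auto
  also have "\<dots> \<le> 2" by (simp add: card_insert_if)
  finally show ?thesis .
next
  case False
  then have "{f \<in> path_edges xs. v \<in> f} = {}" using path_edges_subset by blast
  then show ?thesis by (simp only: card.empty)
qed

text \<open>By distinctness the first and last positions must be consecutive.\<close>

lemma ends_adjacent:
  assumes "distinct xs" "{hd xs, last xs} \<in> path_edges xs"
  shows "length xs = 2"
proof -
  obtain j where j: "Suc j < length xs" "{hd xs, last xs} = {xs ! j, xs ! Suc j}"
    using assms(2) unfolding path_edges_def by blast
  then have ne: "xs \<noteq> []" by auto
  have "{xs ! 0, xs ! (length xs - 1)} = {xs ! j, xs ! Suc j}"
    using j(2) ne by (simp add: hd_conv_nth last_conv_nth)
  then have "xs ! 0 = xs ! j \<and> xs ! (length xs - 1) = xs ! Suc j \<or>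
      xs ! 0 = xs ! Suc j \<and> xs ! (length xs - 1) = xs ! j"
    by (simp only: doubleton_eq_iff)
  then show ?thesis using j(1) ne assms(1) by (auto simp: nth_eq_iff_index_eq)
qed

section \<open>Embeddings, their unions and degrees\<close>

definition embeds ::
  "'b set \<Rightarrow> 'b set set \<Rightarrow> ('b \<Rightarrow> 'a) \<Rightarrow> ('b set \<Rightarrow> 'a list) \<Rightarrow> 'a set set \<Rightarrow> bool" where
  "embeds VK EK \<phi> P E \<longleftrightarrow> inj_on \<phi> VK \<and>
     (\<forall>e\<in>EK. is_path E (P e) \<and> {hd (P e), last (P e)} = \<phi> ` e \<and>
              set (P e) \<inter> \<phi> ` VK = \<phi> ` e) \<and>
     (\<forall>e\<in>EK. \<forall>e'\<in>EK. e \<noteq> e' \<longrightarrow> set (P e) \<inter> set (P e') \<subseteq> \<phi> ` (e \<inter> e'))"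

lemma embedsD:
  assumes "embeds VK EK \<phi> P E"
  shows "inj_on \<phi> VK"
    "\<And>e. e \<in> EK \<Longrightarrow> distinct (P e) \<and> length (P e) \<ge> 2 \<and> walk E (P e)"
    "\<And>e. e \<in> EK \<Longrightarrow> {hd (P e), last (P e)} = \<phi> ` e"
    "\<And>e. e \<in> EK \<Longrightarrow> set (P e) \<inter> \<phi> ` VK = \<phi> ` e"
    "\<And>e e'. e \<in> EK \<Longrightarrow> e' \<in> EK \<Longrightarrow> e \<noteq> e' \<Longrightarrow> set (P e) \<inter> set (P e') \<subseteq> \<phi> ` (e \<inter> e')"
  using assms unfolding embeds_def is_path_iff by blast+

text \<open>\<open>embeds\<close> omits that the paths exhaust the host graph, so it also describes
  subdivisions inside a larger graph and can be composed.\<close>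

lemma subdivision_of_iff:
  "subdivision_of VK EK V E \<longleftrightarrow> graph VK EK \<and> graph V E \<and>
     (\<exists>\<phi> P. embeds VK EK \<phi> P E \<and> \<phi> ` VK \<subseteq> V \<and>
        V = \<phi> ` VK \<union> (\<Union>e\<in>EK. set (P e)) \<and> E = (\<Union>e\<in>EK. path_edges (P e)))"
  unfolding subdivision_of_def embeds_def by blast

text \<open>Two paths of an embedding share at most one vertex, so they share no edge.\<close>
lemma embeds_edge_disjoint:
  assumes K: "graph VK EK" and em: "embeds VK EK \<phi> P E"
    and e: "e \<in> EK" "e' \<in> EK" "e \<noteq> e'"
    and f: "f \<in> path_edges (P e)" "f \<in> path_edges (P e')"
  shows False
proof -
  have c: "card e = 2" "card e' = 2" using K e unfolding graph_def by blast+
  then have fin: "finite e" "finite e'" by (simp_all add: card_ge_0_finite)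
  have "e \<inter> e' \<subset> e"
    using c e(3) fin by (metis card_subset_eq inf.absorb_iff2 inf_le1 inf_le2 psubsetI)
  then have "card (e \<inter> e') < 2" using psubset_card_mono[OF fin(1)] c by metis
  moreover have "f \<subseteq> \<phi> ` (e \<inter> e')"
    using path_edges_subset[OF f(1)] path_edges_subset[OF f(2)] embedsD(5)[OF em e] by blast
  then have "card f \<le> card (e \<inter> e')" using fin by (meson surj_card_le finite_Int)
  moreover have "card f = 2" using path_edges_card[OF _ f(1)] embedsD(2)[OF em e(1)] by blast
  ultimately show False by simp
qed

lemma embeds_subdivision:
  assumes K: "graph VK EK" and em: "embeds VK EK \<phi> P E" and H: "graph V E" and sub: "\<phi> ` VK \<subseteq> V"
    and V': "V' = \<phi> ` VK \<union> (\<Union>e\<in>EK. set (P e))" and E': "E' = (\<Union>e\<in>EK. path_edges (P e))"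
  shows "subgraph V' E' V E" "subdivision_of VK EK V' E'"
proof -
  have pe: "path_edges (P e) \<subseteq> E" if "e \<in> EK" for e
    using embedsD(2)[OF em that] path_edges_walk by blast
  have "set (P e) \<subseteq> V" if "e \<in> EK" for e
  proof -
    have "set (P e) = \<Union> (path_edges (P e))"
      using Union_path_edges embedsD(2)[OF em that] by metis
    then show ?thesis using pe[OF that] H unfolding graph_def by blast
  qed
  then have VV: "V' \<subseteq> V" using sub unfolding V' by blast
  have EE: "E' \<subseteq> E" using pe unfolding E' by blast
  have "f \<subseteq> V'" if "f \<in> E'" for f
    using that path_edges_subset unfolding E' V' by blast
  moreover have "finite V'" using H VV finite_subset unfolding graph_def by metis
  moreover have "card f = 2" if "f \<in> E'" for f using H EE that unfolding graph_def by blast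
  ultimately have g: "graph V' E'" unfolding graph_def by blast
  show "subgraph V' E' V E" using g VV EE unfolding subgraph_def by blast
  have "walk E' (P e)" if "e \<in> EK" for e
    unfolding path_edges_walk E' using that by blast
  then have "embeds VK EK \<phi> P E'"
    using em unfolding embeds_def is_path_iff by blast
  then show "subdivision_of VK EK V' E'"
    unfolding subdivision_of_iff using K g V' E' by blast
qed

text \<open>Paths meet only over common ends, so \<open>v\<close> lies on at most one path, which
  has at most two edges at it.\<close>

lemma embeds_degree_interior:
  assumes em: "embeds VK EK \<phi> P E" and E': "E' = (\<Union>e\<in>EK. path_edges (P e))" and v: "v \<notin> \<phi> ` VK"
    and K: "graph VK EK"
  shows "degree E' v \<le> 2"
proof (cases "\<exists>e\<in>EK. v \<in> set (P e)")
  case True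
  then obtain e where e: "e \<in> EK" "v \<in> set (P e)" by blast
  have "{f \<in> E'. v \<in> f} \<subseteq> {f \<in> path_edges (P e). v \<in> f}"
  proof
    fix f assume "f \<in> {f \<in> E'. v \<in> f}"
    then obtain e' where e': "e' \<in> EK" "f \<in> path_edges (P e')" "v \<in> f" unfolding E' by blast
    then have v': "v \<in> set (P e')" using path_edges_subset by blast
    have "e \<subseteq> VK" using K e unfolding graph_def by blast
    then have "e = e'" using embedsD(5)[OF em e(1) e'(1)] e(2) v' v by blast
    then show "f \<in> {f \<in> path_edges (P e). v \<in> f}" using e' by blast
  qed
  then have "degree E' v \<le> card {f \<in> path_edges (P e). v \<in> f}"
    unfolding degree_def by (intro card_mono) (simp_all add: finite_path_edges)
  also have "\<dots> \<le> 2"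
    by (rule card_path_edges_at) (use embedsD(2)[OF em e(1)] in blast)
  finally show ?thesis .
next
  case False
  then have "{f \<in> E'. v \<in> f} = {}" using path_edges_subset unfolding E' by blast
  then show ?thesis unfolding degree_def by (simp only: card.empty)
qed

text \<open>Choose on each path at \<open>u\<close> an edge containing its image; the choices differ
  because paths share no edge.\<close>

lemma embeds_degree_branch:
  assumes em: "embeds VK EK \<phi> P E" and E': "E' = (\<Union>e\<in>EK. path_edges (P e))"
    and K: "graph VK EK"
  shows "degree EK u \<le> degree E' (\<phi> u)"
proof -
  have "\<exists>f. f \<in> path_edges (P e) \<and> \<phi> u \<in> f" if "e \<in> EK" "u \<in> e" for e
  proof -
    have "\<phi> u \<in> set (P e)" using embedsD(4)[OF em that(1)] that(2) by blast
    then show ?thesis using Union_path_edges embedsD(2)[OF em that(1)] by (metis UnionE)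
  qed
  then obtain g where g: "\<And>e. e \<in> EK \<Longrightarrow> u \<in> e \<Longrightarrow> g e \<in> path_edges (P e) \<and> \<phi> u \<in> g e"
    by metis
  have "finite VK" "EK \<subseteq> Pow VK" using K unfolding graph_def by blast+
  then have fin: "finite E'" unfolding E' using finite_path_edges finite_subset by blast
  have "inj_on g {e \<in> EK. u \<in> e}"
  proof (rule inj_onI)
    fix e e' assume *: "e \<in> {e \<in> EK. u \<in> e}" "e' \<in> {e \<in> EK. u \<in> e}" "g e = g e'"
    show "e = e'"
    proof (rule ccontr)
      assume "e \<noteq> e'"
      then show False
        using embeds_edge_disjoint[OF K em, of e e' "g e"] * g[of e] g[of e'] by simp
    qed
  qed
  moreover have "g ` {e \<in> EK. u \<in> e} \<subseteq> {f \<in> E'. \<phi> u \<in> f}" using g unfolding E' by blast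
  ultimately show ?thesis unfolding degree_def using fin by (intro card_inj_on_le) auto
qed

section \<open>Composition of embeddings\<close>

lemma lift_edge:
  assumes em: "embeds VJ EJ \<psi> Q E" and e: "{u, v} \<in> EJ"
  shows "\<exists>ys. is_path E ys \<and> hd ys = \<psi> u \<and> last ys = \<psi> v \<and> set ys = set (Q {u, v}) \<and>
           length ys = length (Q {u, v})"
proof -
  have p: "is_path E (Q {u, v})" using embedsD(2)[OF em e] by (simp add: is_path_iff)
  then have ne: "Q {u, v} \<noteq> []" by (auto simp: is_path_def)
  have "{hd (Q {u, v}), last (Q {u, v})} = {\<psi> u, \<psi> v}" using embedsD(3)[OF em e] by simp
  \<comment> \<open>\<open>Q\<close> is indexed by unordered edges, so its path may run from
    \<open>v\<close> to \<open>u\<close> and must then be reversed.\<close>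
  then consider "hd (Q {u, v}) = \<psi> u" "last (Q {u, v}) = \<psi> v"
    | "hd (Q {u, v}) = \<psi> v" "last (Q {u, v}) = \<psi> u" by (auto simp: doubleton_eq_iff)
  then show ?thesis
  proof cases
    case 1
    then show ?thesis using p by blast
  next
    case 2
    then show ?thesis using p ne
      by (intro exI[of _ "rev (Q {u, v})"])
         (simp add: is_path_iff hd_rev last_rev insert_commute[of _ _ "{}"])
  qed
qed

text \<open>Concatenate the paths of successive edges. The length clause records that the lift is a
  single edge only if it comes from one unsubdivided edge.\<close>

lemma lift_path:
  assumes em: "embeds VJ EJ \<psi> Q E"
  shows "distinct xs \<Longrightarrow> length xs \<ge> 2 \<Longrightarrow> walk EJ xs \<Longrightarrow>
     \<exists>ys. is_path E ys \<and> hd ys = \<psi> (hd xs) \<and> last ys = \<psi> (last xs) \<and>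
       set ys = (\<Union>e\<in>path_edges xs. set (Q e)) \<and>
       (length ys = 2 \<longrightarrow> length xs = 2 \<and> length (Q {hd xs, last xs}) = 2)"
proof (induction xs rule: induct_list012)
  case (3 u v zs)
  have uv: "{u, v} \<in> EJ" using 3(5) by simp
  obtain ys where ys: "is_path E ys" "hd ys = \<psi> u" "last ys = \<psi> v"
    "set ys = set (Q {u, v})" "length ys = length (Q {u, v})" using lift_edge[OF em uv] by blast
  show ?case
  proof (cases "zs = []")
    case True
    then show ?thesis using ys by (intro exI[of _ ys]) simp
  next
    case False
    then have "length (v # zs) \<ge> 2" by (cases zs) simp_all
    then obtain ws where ws: "is_path E ws" "hd ws = \<psi> v" "last ws = \<psi> (last (v # zs))"
      "set ws = (\<Union>e\<in>path_edges (v # zs). set (Q e))"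
      using 3 by auto
    obtain ws' where ws': "ws = \<psi> v # ws'" "ws' \<noteq> []"
    proof (cases ws)
      case (Cons w us)
      then show thesis using that[of us] ws(1,2) by (cases us) (simp_all add: is_path_def)
    qed (use ws(1) in \<open>simp add: is_path_def\<close>)
    obtain ys' where ys': "ys = ys' @ [\<psi> v]" "ys' \<noteq> []"
    proof (cases ys rule: rev_cases)
      case (snoc us w)
      then show thesis using that[of us] ys(1,3) by (cases us) (simp_all add: is_path_def)
    qed (use ys(1) in \<open>simp add: is_path_def\<close>)
    \<comment> \<open>No later edge \<open>f\<close> contains \<open>u\<close>, so the path of
      \<open>f\<close> can meet that of \<open>uv\<close> only over \<open>v\<close>.\<close>
    have "set ys \<inter> set ws \<subseteq> {\<psi> v}"
    proof
      fix x assume "x \<in> set ys \<inter> set ws"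
      then obtain f where f: "x \<in> set (Q {u, v})" "f \<in> path_edges (v # zs)" "x \<in> set (Q f)"
        using ys(4) ws(4) by blast
      have "f \<in> EJ" using f(2) 3(5) path_edges_walk[of EJ "v # zs"] by auto
      moreover have "u \<notin> f" using path_edges_subset[OF f(2)] 3(3) by auto
      ultimately show "x \<in> {\<psi> v}"
        using embedsD(5)[OF em uv, of f] f by blast
    qed
    then have "distinct (ys' @ ws)"
      using ys(1) ws(1) unfolding is_path_iff ws' ys' by auto
    moreover have "walk E (ys' @ \<psi> v # ws')"
      using ys(1) ws(1) ws'(2) unfolding is_path_iff ws'(1) ys' by (simp add: walk_split)
    moreover have "length (ys' @ ws) > 2" using ys'(2) ws' by (cases ys'; cases ws') simp_all
    moreover have "hd (ys' @ ws) = \<psi> u" "last (ys' @ ws) = \<psi> (last (u # v # zs))"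
      using ys(2) ws(3) ys' ws' by simp_all
    moreover have "set (ys' @ ws) = (\<Union>e\<in>path_edges (u # v # zs). set (Q e))"
      using ys(4) ws(4) ws'(1) ys'(1) by auto
    ultimately show ?thesis
      by (intro exI[of _ "ys' @ ws"]) (auto simp: is_path_iff ws'(1))
  qed
qed auto

text \<open>\<open>R e\<close> lifts \<open>P e\<close>. Different paths \<open>P e\<close> share no
  edge, so their lifts meet only over common vertices, which are images of common ends.\<close>

lemma embeds_trans:
  assumes K: "graph VK EK" and em: "embeds VK EK \<phi> P EJ" "embeds VJ EJ \<psi> Q E"
    and sub: "\<phi> ` VK \<subseteq> VJ" and J: "graph VJ EJ"
  shows "\<exists>R. embeds VK EK (\<psi> \<circ> \<phi>) R E \<and>
    (\<forall>e\<in>EK. length (R e) = 2 \<longrightarrow> length (P e) = 2 \<and> length (Q {hd (P e), last (P e)}) = 2)"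
proof -
  have "\<forall>e\<in>EK. \<exists>ys. is_path E ys \<and> hd ys = \<psi> (hd (P e)) \<and> last ys = \<psi> (last (P e)) \<and>
       set ys = (\<Union>f\<in>path_edges (P e). set (Q f)) \<and>
       (length ys = 2 \<longrightarrow> length (P e) = 2 \<and> length (Q {hd (P e), last (P e)}) = 2)"
    using lift_path[OF em(2)] embedsD(2)[OF em(1)] by blast
  then obtain R where R: "\<forall>e\<in>EK. is_path E (R e) \<and> hd (R e) = \<psi> (hd (P e)) \<and>
       last (R e) = \<psi> (last (P e)) \<and> set (R e) = (\<Union>f\<in>path_edges (P e). set (Q f)) \<and>
       (length (R e) = 2 \<longrightarrow> length (P e) = 2 \<and> length (Q {hd (P e), last (P e)}) = 2)"
    by (rule bchoice[THEN exE])
  have pe: "path_edges (P e) \<subseteq> EJ" if "e \<in> EK" for e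
    using embedsD(2)[OF em(1) that] path_edges_walk by blast
  \<comment> \<open>Over \<open>J\<close>, a lift passes through exactly the vertices of
    \<open>P e\<close>, so the condition on branch vertices carries over.\<close>
  have branch: "set (R e) \<inter> \<psi> ` VJ = \<psi> ` set (P e)" if e: "e \<in> EK" for e
  proof -
    have "set (R e) \<inter> \<psi> ` VJ = (\<Union>f\<in>path_edges (P e). set (Q f) \<inter> \<psi> ` VJ)" using R e by blast
    also have "\<dots> = (\<Union>f\<in>path_edges (P e). \<psi> ` f)"
      using embedsD(4)[OF em(2)] pe[OF e] by (intro SUP_cong) blast+
    also have "\<dots> = \<psi> ` (\<Union> (path_edges (P e)))" by blast
    also have "\<dots> = \<psi> ` set (P e)" using Union_path_edges embedsD(2)[OF em(1) e] by metis
    finally show ?thesis .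
  qed
  have PJ: "set (P e) \<subseteq> VJ" if e: "e \<in> EK" for e
  proof -
    have "set (P e) = \<Union> (path_edges (P e))" using Union_path_edges embedsD(2)[OF em(1) e] by metis
    then show ?thesis using pe[OF e] J unfolding graph_def by blast
  qed
  have inj: "inj_on \<psi> VJ" using embedsD(1)[OF em(2)] .
  have "embeds VK EK (\<psi> \<circ> \<phi>) R E"
    unfolding embeds_def
  proof (intro conjI ballI impI)
    show "inj_on (\<psi> \<circ> \<phi>) VK"
      using embedsD(1)[OF em(1)] inj sub by (meson comp_inj_on inj_on_subset)
  next
    fix e assume e: "e \<in> EK"
    show "is_path E (R e)" using R e by blast
    have "{hd (R e), last (R e)} = \<psi> ` {hd (P e), last (P e)}" using R e by simp
    then show "{hd (R e), last (R e)} = (\<psi> \<circ> \<phi>) ` e"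
      unfolding embedsD(3)[OF em(1) e] by (simp add: image_comp)
    have "(\<psi> \<circ> \<phi>) ` VK \<subseteq> \<psi> ` VJ" using sub by auto
    then have "set (R e) \<inter> (\<psi> \<circ> \<phi>) ` VK = \<psi> ` set (P e) \<inter> \<psi> ` \<phi> ` VK"
      using branch[OF e] by (auto simp: image_comp)
    also have "\<dots> = \<psi> ` (set (P e) \<inter> \<phi> ` VK)"
      using inj_on_image_Int[OF inj PJ[OF e] sub] by simp
    finally show "set (R e) \<inter> (\<psi> \<circ> \<phi>) ` VK = (\<psi> \<circ> \<phi>) ` e"
      unfolding embedsD(4)[OF em(1) e] by (simp add: image_comp)
  next
    fix e e' assume e: "e \<in> EK" "e' \<in> EK" "e \<noteq> e'"
    show "set (R e) \<inter> set (R e') \<subseteq> (\<psi> \<circ> \<phi>) ` (e \<inter> e')"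
    proof
      fix x assume "x \<in> set (R e) \<inter> set (R e')"
      then obtain f f' where f: "f \<in> path_edges (P e)" "x \<in> set (Q f)"
        and f': "f' \<in> path_edges (P e')" "x \<in> set (Q f')" using R e by blast
      have ne: "f \<noteq> f'" using embeds_edge_disjoint[OF K em(1) e] f f' by blast
      have "f \<in> EJ" "f' \<in> EJ" using pe e f f' by blast+
      then have "x \<in> \<psi> ` (f \<inter> f')" using embedsD(5)[OF em(2) _ _ ne] f f' by blast
      then have "x \<in> \<psi> ` (set (P e) \<inter> set (P e'))"
        using path_edges_subset[OF f(1)] path_edges_subset[OF f'(1)] by blast
      then show "x \<in> (\<psi> \<circ> \<phi>) ` (e \<inter> e')"
        using embedsD(5)[OF em(1) e] by auto
    qed
  qed
  then show ?thesis using R by blast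
qed

lemma subdivision_of_relabel:
  assumes f: "bij_betw f VK VJ" and EJ: "EJ = (\<lambda>e. f ` e) ` EK" and K: "graph VK EK"
    and sub: "subdivision_of VJ EJ V E"
  shows "subdivision_of VK EK V E"
proof -
  obtain \<psi> Q where H: "graph V E" and em: "embeds VJ EJ \<psi> Q E" and VE: "\<psi> ` VJ \<subseteq> V"
    "V = \<psi> ` VJ \<union> (\<Union>e\<in>EJ. set (Q e))" "E = (\<Union>e\<in>EJ. path_edges (Q e))"
    using sub unfolding subdivision_of_iff by blast
  have VJ: "VJ = f ` VK" and inj: "inj_on f VK" using f by (auto simp: bij_betw_def)
  have K': "e \<subseteq> VK" if "e \<in> EK" for e using K that unfolding graph_def by blast
  have fe: "f ` e \<in> EJ" if "e \<in> EK" for e using that EJ by blast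
  have "embeds VK EK (\<psi> \<circ> f) (\<lambda>e. Q (f ` e)) E"
    unfolding embeds_def
  proof (intro conjI ballI impI)
    show "inj_on (\<psi> \<circ> f) VK" using embedsD(1)[OF em] inj VJ by (metis comp_inj_on)
  next
    fix e assume e: "e \<in> EK"
    show "is_path E (Q (f ` e))" using embedsD(2)[OF em fe[OF e]] by (simp add: is_path_iff)
    show "{hd (Q (f ` e)), last (Q (f ` e))} = (\<psi> \<circ> f) ` e"
      using embedsD(3)[OF em fe[OF e]] by (simp add: image_comp)
    show "set (Q (f ` e)) \<inter> (\<psi> \<circ> f) ` VK = (\<psi> \<circ> f) ` e"
      using embedsD(4)[OF em fe[OF e]] by (simp add: VJ image_comp)
  next
    fix e e' assume e: "e \<in> EK" "e' \<in> EK" "e \<noteq> e'"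
    have "f ` e \<noteq> f ` e'" using inj_on_image_eq_iff[OF inj K'[OF e(1)] K'[OF e(2)]] e(3) by simp
    then have "set (Q (f ` e)) \<inter> set (Q (f ` e')) \<subseteq> \<psi> ` (f ` e \<inter> f ` e')"
      using embedsD(5)[OF em fe[OF e(1)] fe[OF e(2)]] by blast
    then show "set (Q (f ` e)) \<inter> set (Q (f ` e')) \<subseteq> (\<psi> \<circ> f) ` (e \<inter> e')"
      using inj_on_image_Int[OF inj K'[OF e(1)] K'[OF e(2)]]
      by (metis image_comp)
  qed
  moreover have "V = (\<psi> \<circ> f) ` VK \<union> (\<Union>e\<in>EK. set (Q (f ` e)))"
    using VE(2) unfolding VJ EJ by (simp add: image_comp)
  moreover have "E = (\<Union>e\<in>EK. path_edges (Q (f ` e)))" using VE(3) unfolding EJ by simp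
  ultimately show ?thesis unfolding subdivision_of_iff using K H by blast
qed

lemma subdivision_of_direct:
  assumes sub: "embeds VJ EJ \<psi> Q E" "V = \<psi> ` VJ \<union> (\<Union>e\<in>EJ. set (Q e))"
    "E = (\<Union>e\<in>EJ. path_edges (Q e))"
    and J: "graph VJ EJ" and direct: "\<forall>e\<in>EJ. length (Q e) = 2"
  shows "isomorphic VJ EJ V E"
proof -
  have Q: "set (Q e) = \<psi> ` e \<and> path_edges (Q e) = {\<psi> ` e}" if e: "e \<in> EJ" for e
  proof -
    obtain x y where xy: "Q e = [x, y]" using direct e by (auto simp: length_Suc_conv numeral_2_eq_2)
    then have "{x, y} = \<psi> ` e" using embedsD(3)[OF sub(1) e] by simp
    then show ?thesis by (simp add: xy)
  qed
  have "\<psi> ` e \<subseteq> \<psi> ` VJ" if "e \<in> EJ" for e using J that unfolding graph_def by blast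
  then have "V = \<psi> ` VJ" using sub(2) Q by auto
  then have "bij_betw \<psi> VJ V" using embedsD(1)[OF sub(1)] by (simp add: bij_betw_def)
  moreover have "E = (\<lambda>e. \<psi> ` e) ` EJ" using sub(3) Q by auto
  ultimately show ?thesis unfolding isomorphic_def by blast
qed

lemma isomorphic_trans:
  assumes "isomorphic V1 E1 V2 E2" "isomorphic V2 E2 V3 E3"
  shows "isomorphic V1 E1 V3 E3"
proof -
  obtain f g where "bij_betw f V1 V2" "E2 = (\<lambda>e. f ` e) ` E1" "bij_betw g V2 V3" "E3 = (\<lambda>e. g ` e) ` E2"
    using assms unfolding isomorphic_def by blast
  then show ?thesis unfolding isomorphic_def
    by (intro exI[of _ "g \<circ> f"]) (simp add: bij_betw_trans[of f _ _ g] image_image comp_def[symmetric])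
qed

section \<open>Embeddings of the concrete K_4\<close>

lemma K4_E_eq: "K4_E = {{0, 1}, {0, 2}, {0, 3}, {1, 2}, {1, 3}, {2, 3}}"
proof
  have "\<exists>i j. {a, b} = {i, j} \<and> i < 4 \<and> j < 4 \<and> i \<noteq> j" if "a < 4" "b < 4" "a \<noteq> b" for a b :: nat
    using that by blast
  then show "{{0, 1}, {0, 2}, {0, 3}, {1, 2}, {1, 3}, {2, 3}} \<subseteq> K4_E" unfolding K4_E_def by simp
  show "K4_E \<subseteq> {{0, 1}, {0, 2}, {0, 3}, {1, 2}, {1, 3}, {2, 3}}"
  proof
    fix e assume "e \<in> K4_E"
    then obtain i j where ij: "e = {i, j}" "i < 4" "j < 4" "i \<noteq> j" unfolding K4_E_def by blast
    then have "i \<in> {0, 1, 2, 3}" "j \<in> {0, 1, 2, 3}" by auto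
    with ij(1,4) show "e \<in> {{0, 1}, {0, 2}, {0, 3}, {1, 2}, {1, 3}, {2, 3}}"
      by (elim insertE emptyE) (simp_all add: doubleton_eq_iff)
  qed
qed

lemma graph_K4: "graph K4_V K4_E"
  unfolding graph_def K4_E_eq K4_V_def by auto

lemma degree_K4: "degree K4_E 0 = 3"
proof -
  have "{e \<in> K4_E. 0 \<in> e} = {{0, 1}, {0, 2}, {0, 3}}" unfolding K4_E_eq by auto
  then show ?thesis by (simp add: degree_def card_insert_if doubleton_eq_iff)
qed

text \<open>Disjoint interiors \<open>I e\<close> off the branch vertices leave only ends to be
  shared, and by injectivity these are images of common vertices of \<open>e\<close> and
  \<open>e'\<close>.\<close>

lemma embedsI:
  assumes inj: "inj_on \<phi> VK" and K: "graph VK EK"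
    and P: "\<And>e. e \<in> EK \<Longrightarrow> is_path E (P e) \<and> {hd (P e), last (P e)} = \<phi> ` e \<and>
        set (P e) = \<phi> ` e \<union> I e \<and> I e \<inter> \<phi> ` VK = {}"
    and I: "\<And>e e'. e \<in> EK \<Longrightarrow> e' \<in> EK \<Longrightarrow> e \<noteq> e' \<Longrightarrow> I e \<inter> I e' = {}"
  shows "embeds VK EK \<phi> P E"
proof -
  have K': "e \<subseteq> VK" if "e \<in> EK" for e using K that unfolding graph_def by blast
  have "set (P e) \<inter> \<phi> ` VK = \<phi> ` e" if e: "e \<in> EK" for e
    using P[OF e] image_mono[OF K'[OF e], of \<phi>] by blast
  moreover have "set (P e) \<inter> set (P e') \<subseteq> \<phi> ` (e \<inter> e')" if e: "e \<in> EK" "e' \<in> EK" "e \<noteq> e'" for e e'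
  proof -
    have "(S \<union> T) \<inter> (S' \<union> T') \<subseteq> S \<inter> S'"
      if "S \<subseteq> W" "S' \<subseteq> W" "T \<inter> W = {}" "T' \<inter> W = {}" "T \<inter> T' = {}" for S S' T T' W :: "'b set"
      using that by blast
    then have "set (P e) \<inter> set (P e') \<subseteq> \<phi> ` e \<inter> \<phi> ` e'"
      using P[OF e(1)] P[OF e(2)] I[OF e] image_mono[OF K'[OF e(1)], of \<phi>]
        image_mono[OF K'[OF e(2)], of \<phi>] by metis
    also have "\<dots> = \<phi> ` (e \<inter> e')"
      by (rule inj_on_image_Int[OF inj K'[OF e(1)] K'[OF e(2)], symmetric])
    finally show ?thesis .
  qed
  ultimately show ?thesis unfolding embeds_def using inj P by (intro conjI ballI impI) simp_all
qed

lemma K4sub_embeds: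
  assumes K: "K4sub E a b c d p1 p2 p3 p4 p5 p6"
  shows "\<exists>\<phi> P. embeds K4_V K4_E \<phi> P E \<and> \<phi> ` K4_V = {a, b, c, d} \<and>
    P {0, 1} = a # p1 @ [b] \<and> P {0, 2} = a # p2 @ [c]"
proof -
  define \<phi> :: "nat \<Rightarrow> 'a" where "\<phi> i = [a, b, c, d] ! i" for i
  define I :: "nat set \<Rightarrow> 'a list" where
    "I e = (if e = {0, 1} then p1 else if e = {0, 2} then p2 else if e = {0, 3} then p3
            else if e = {1, 2} then p4 else if e = {1, 3} then p5 else p6)" for e
  \<comment> \<open>Orienting from \<open>Min e\<close> to \<open>Max e\<close> matches the order of
    ends in \<open>K4sub\<close>, with 0, 1, 2, 3 standing for \<open>a\<close>, \<open>b\<close>,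
    \<open>c\<close>, \<open>d\<close>.\<close>
  define P where "P e = \<phi> (Min e) # I e @ [\<phi> (Max e)]" for e
  have dis: "distinct ([a, b, c, d] @ p1 @ p2 @ p3 @ p4 @ p5 @ p6)"
    and w: "walk E (a # p1 @ [b])" "walk E (a # p2 @ [c])" "walk E (a # p3 @ [d])"
      "walk E (b # p4 @ [c])" "walk E (b # p5 @ [d])" "walk E (c # p6 @ [d])"
    using K unfolding K4sub_def by blast+
  have \<phi>: "\<phi> 0 = a" "\<phi> 1 = b" "\<phi> 2 = c" "\<phi> 3 = d" "\<phi> (Suc 0) = b" "\<phi> (Suc (Suc 0)) = c"
    by (simp_all add: \<phi>_def)
  have I: "I {0, 1} = p1" "I {0, 2} = p2" "I {0, 3} = p3" "I {1, 2} = p4" "I {1, 3} = p5"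
    "I {2, 3} = p6"
    by (simp_all add: I_def doubleton_eq_iff)
  have P: "P {0, 1} = a # p1 @ [b]" "P {0, 2} = a # p2 @ [c]" "P {0, 3} = a # p3 @ [d]"
    "P {1, 2} = b # p4 @ [c]" "P {1, 3} = b # p5 @ [d]" "P {2, 3} = c # p6 @ [d]"
    unfolding P_def I by (simp_all add: \<phi>)
  have V: "K4_V = {0, 1, 2, 3}" unfolding K4_V_def by auto
  have img: "\<phi> ` K4_V = {a, b, c, d}" unfolding V by (simp add: \<phi>)
  have inj: "inj_on \<phi> K4_V" using dis unfolding V by (auto simp: inj_on_def \<phi>)
  have path: "is_path E (P e) \<and> {hd (P e), last (P e)} = \<phi> ` e \<and>
        set (P e) = \<phi> ` e \<union> set (I e) \<and> set (I e) \<inter> \<phi> ` K4_V = {}" if "e \<in> K4_E" for e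
  proof -
    have *: ?thesis if e: "e = {i, j}" and Pe: "P e = \<phi> i # I e @ [\<phi> j]" and we: "walk E (P e)"
      and de: "distinct (P e)" and Ie: "set (I e) \<inter> {a, b, c, d} = {}" for i j
      using we de Ie unfolding is_path_iff img by (simp add: Pe) (auto simp: e)
    have D1: "distinct (a # p1 @ [b])" "distinct (a # p2 @ [c])" "distinct (a # p3 @ [d])"
      "distinct (b # p4 @ [c])" "distinct (b # p5 @ [d])" "distinct (c # p6 @ [d])"
      by (rule distinct_submset[OF _ dis], simp add: subseteq_mset_def)+
    have D2: "set p \<inter> {a, b, c, d} = {}" if "p \<in> {p1, p2, p3, p4, p5, p6}" for p
      using dis that by auto
    from that[unfolded K4_E_eq] show ?thesis
    proof (elim insertE emptyE)
      assume e: "e = {0, 1}"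
      show ?thesis by (rule *[OF e]; unfold e P I) (use w D1 D2 in \<open>simp_all add: \<phi>\<close>)
    next
      assume e: "e = {0, 2}"
      show ?thesis by (rule *[OF e]; unfold e P I) (use w D1 D2 in \<open>simp_all add: \<phi>\<close>)
    next
      assume e: "e = {0, 3}"
      show ?thesis by (rule *[OF e]; unfold e P I) (use w D1 D2 in \<open>simp_all add: \<phi>\<close>)
    next
      assume e: "e = {1, 2}"
      show ?thesis by (rule *[OF e]; unfold e P I) (use w D1 D2 in \<open>simp_all add: \<phi>\<close>)
    next
      assume e: "e = {1, 3}"
      show ?thesis by (rule *[OF e]; unfold e P I) (use w D1 D2 in \<open>simp_all add: \<phi>\<close>)
    next
      assume e: "e = {2, 3}"
      show ?thesis by (rule *[OF e]; unfold e P I) (use w D1 D2 in \<open>simp_all add: \<phi>\<close>)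
    qed
  qed
  have dI: "set p1 \<inter> set p2 = {}" "set p1 \<inter> set p3 = {}" "set p1 \<inter> set p4 = {}"
    "set p1 \<inter> set p5 = {}" "set p1 \<inter> set p6 = {}" "set p2 \<inter> set p3 = {}" "set p2 \<inter> set p4 = {}"
    "set p2 \<inter> set p5 = {}" "set p2 \<inter> set p6 = {}" "set p3 \<inter> set p4 = {}" "set p3 \<inter> set p5 = {}"
    "set p3 \<inter> set p6 = {}" "set p4 \<inter> set p5 = {}" "set p4 \<inter> set p6 = {}" "set p5 \<inter> set p6 = {}"
    using dis by (simp_all add: Int_Un_distrib)
  have int: "set (I e) \<inter> set (I e') = {}" if "e \<in> K4_E" "e' \<in> K4_E" "e \<noteq> e'" for e e'
    using that unfolding K4_E_eq
    by (elim insertE emptyE) (simp_all only: I dI dI[THEN trans[OF Int_commute]] simp_thms)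
  have "embeds K4_V K4_E \<phi> P E"
    by (rule embedsI[OF inj graph_K4 path int])
  then show ?thesis using img P by blast
qed

text \<open>At a branch vertex, a cycle uses two of the three incident paths, hence at least one of the
  two that are not single edges.\<close>
lemma K4_no_branch_cycle:
  assumes em: "embeds K4_V K4_E \<phi> P E"
    and V': "V' = \<phi> ` K4_V \<union> (\<Union>e\<in>K4_E. set (P e))" and E': "E' = (\<Union>e\<in>K4_E. path_edges (P e))"
    and len: "length (P {0, 1}) \<noteq> 2" "length (P {0, 2}) \<noteq> 2"
  shows "\<not> (\<exists>C. is_cycle E' C \<and> set C = branch_vertices V' E')"
proof
  assume "\<exists>C. is_cycle E' C \<and> set C = branch_vertices V' E'"
  then obtain C where C: "is_cycle E' C" "set C = branch_vertices V' E'" by blast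
  have sub: "set C \<subseteq> \<phi> ` K4_V"
  proof
    fix v assume "v \<in> set C"
    then have "degree E' v \<ge> 3" using C(2) by (simp add: branch_vertices_def)
    then show "v \<in> \<phi> ` K4_V" using embeds_degree_interior[OF em E' _ graph_K4, of v] by fastforce
  qed
  have "0 \<in> K4_V" by (simp add: K4_V_def)
  then have "\<phi> 0 \<in> set C"
    using C(2) embeds_degree_branch[OF em E' graph_K4, of 0] degree_K4 V'
    by (simp add: branch_vertices_def)
  then obtain i where i: "i < length C" "C ! i = \<phi> 0" by (auto simp: in_set_conv_nth)
  \<comment> \<open>Such an edge could only lie on the path for \<open>{0, k}\<close> and would join
    its ends, forcing length 2 against \<open>len\<close>.\<close>
  have no: "{\<phi> 0, \<phi> k} \<notin> E'" if k: "k \<in> {1, 2}" for k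
  proof
    assume "{\<phi> 0, \<phi> k} \<in> E'"
    then obtain e where e: "e \<in> K4_E" "{\<phi> 0, \<phi> k} \<in> path_edges (P e)" unfolding E' by blast
    have kV: "{0, k} \<subseteq> K4_V" using k by (auto simp: K4_V_def)
    have "\<phi> ` {0, k} \<subseteq> set (P e) \<inter> \<phi> ` K4_V" using path_edges_subset[OF e(2)] kV by auto
    then have "\<phi> ` {0, k} \<subseteq> \<phi> ` e" using embedsD(4)[OF em e(1)] by simp
    moreover have eV: "e \<subseteq> K4_V" "card e = 2" using graph_K4 e(1) unfolding graph_def by blast+
    moreover have "x \<in> e" if "x \<in> {0, k}" "\<phi> x \<in> \<phi> ` e" for x
      using inj_on_image_mem_iff[OF embedsD(1)[OF em] _ eV(1), of x] that kV by blast
    ultimately have "{0, k} \<subseteq> e" by blast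
    moreover have "card {0, k} = 2" using k by auto
    moreover have "finite e" using eV(2) by (simp add: card_ge_0_finite)
    ultimately have ek: "e = {0, k}" using eV(2) by (metis card_subset_eq)
    then have "{hd (P e), last (P e)} \<in> path_edges (P e)"
      using embedsD(3)[OF em e(1)] e(2) by simp
    then have "length (P e) = 2" using ends_adjacent embedsD(2)[OF em e(1)] by blast
    then show False using len k ek by auto
  qed
  define n where "n = length C"
  define s where "s = Suc i mod n"
  \<comment> \<open>The cyclic predecessor of \<open>i\<close>; adding \<open>n\<close> first avoids
    truncated subtraction at \<open>i = 0\<close>.\<close>
  define r where "r = (i + n - 1) mod n"
  have n: "n \<ge> 3" "distinct C" and
    cyc: "\<And>j. j < n \<Longrightarrow> {C ! j, C ! (Suc j mod n)} \<in> E'" using C(1) by (auto simp: is_cycle_def n_def)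
  have s: "s = (if Suc i = n then 0 else Suc i)" using i by (auto simp: s_def n_def)
  have r: "r = (if i = 0 then n - 1 else i - 1)"
  proof (cases i)
    case 0
    then show ?thesis using n by (simp add: r_def)
  next
    case (Suc j)
    then have "r = (j + n) mod n" by (simp add: r_def)
    then show ?thesis using Suc i by (simp add: n_def)
  qed
  have srn: "s < n" "r < n" "s \<noteq> r" "s \<noteq> i" "r \<noteq> i" "Suc r mod n = i"
    using s r i n by (auto simp: n_def split: if_splits)
  have e1: "{\<phi> 0, C ! s} \<in> E'" using cyc[of i] i by (simp add: s_def n_def)
  have e2: "{\<phi> 0, C ! r} \<in> E'" using cyc[OF srn(2)] srn(6) i by (simp add: insert_commute)
  have "C ! s \<noteq> C ! r" "C ! s \<noteq> \<phi> 0" "C ! r \<noteq> \<phi> 0"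
    using srn i n nth_eq_iff_index_eq[OF n(2)] by (metis n_def)+
  moreover have "C ! s \<in> \<phi> ` {0, 1, 2, 3}" "C ! r \<in> \<phi> ` {0, 1, 2, 3}"
  proof -
    have "K4_V = {0, 1, 2, 3}" unfolding K4_V_def by auto
    then show "C ! s \<in> \<phi> ` {0, 1, 2, 3}" "C ! r \<in> \<phi> ` {0, 1, 2, 3}"
      using sub srn nth_mem n_def by blast+
  qed
  \<comment> \<open>The two cycle neighbours of \<open>\<phi> 0\<close> are distinct and among the
    three other branch vertices, so they cannot both be \<open>\<phi> 3\<close>.\<close>
  ultimately have "C ! s \<in> {\<phi> 1, \<phi> 2} \<or> C ! r \<in> {\<phi> 1, \<phi> 2}" by auto
  then show False using no[of 1] no[of 2] e1 e2 by auto
qed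

section \<open>Recognising K_4 and K_{3,3}, and the conclusion\<close>

lemma complete_4_isomorphic:
  assumes "card V = 4" "E = {{u, v} | u v. u \<in> V \<and> v \<in> V \<and> u \<noteq> v}"
  shows "isomorphic K4_V K4_E V E"
proof -
  have "finite V" using assms(1) by (simp add: card_ge_0_finite)
  then obtain f where f: "bij_betw f {0..<4::nat} V"
    using ex_bij_betw_nat_finite assms(1) by metis
  then have V: "V = f ` {0..<4}" and inj: "inj_on f {0..<4}" by (auto simp: bij_betw_def)
  have "E = (\<lambda>e. f ` e) ` K4_E"
  proof
    show "E \<subseteq> (\<lambda>e. f ` e) ` K4_E"
    proof
      fix e assume "e \<in> E"
      then obtain i j where "i < 4" "j < 4" "f i \<noteq> f j" "e = {f i, f j}" unfolding assms(2) V by auto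
      then have "e = f ` {i, j}" "{i, j} \<in> K4_E" unfolding K4_E_def by auto
      then show "e \<in> (\<lambda>e. f ` e) ` K4_E" by blast
    qed
    show "(\<lambda>e. f ` e) ` K4_E \<subseteq> E"
    proof
      fix e assume "e \<in> (\<lambda>e. f ` e) ` K4_E"
      then obtain i j where ij: "i < 4" "j < 4" "i \<noteq> j" "e = {f i, f j}" unfolding K4_E_def by auto
      moreover have "f i \<noteq> f j" using inj ij by (auto simp: inj_on_def)
      ultimately show "e \<in> E" unfolding assms(2) V
        by (intro CollectI exI[of _ "f i"] exI[of _ "f j"]) simp
    qed
  qed
  then show ?thesis using f unfolding isomorphic_def K4_V_def by blast
qed

lemma complete_bipartite_isomorphic:
  assumes c: "card X = 3" "card Y = 3" "X \<inter> Y = {}"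
    and VE: "V = X \<union> Y" "E = {{p, q} | p q. p \<in> X \<and> q \<in> Y}"
  shows "isomorphic K33_V K33_E V E"
proof -
  have "finite X" "finite Y" using c by (simp_all add: card_ge_0_finite)
  then obtain g h where g: "bij_betw g {0..<3::nat} X" and h: "bij_betw h {3..<6::nat} Y"
    using finite_same_card_bij[of "{0..<3::nat}" X] finite_same_card_bij[of "{3..<6::nat}" Y] c by auto
  define f where "f i = (if i \<in> {0..<3} then g i else h i)" for i
  have un: "{0..<3::nat} \<union> {3..<6} = {0..<6}" by auto
  have f: "bij_betw f {0..<6} (X \<union> Y)"
    unfolding un[symmetric] f_def
    by (rule bij_betw_disjoint_Un[OF g h]) (use c in auto)
  have X: "X = f ` {0..<3}" using g by (auto simp: bij_betw_def f_def)
  have Y: "Y = f ` {3..<6}" using h by (auto simp: bij_betw_def f_def)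
  have "E = (\<lambda>e. f ` e) ` K33_E"
  proof
    show "E \<subseteq> (\<lambda>e. f ` e) ` K33_E"
    proof
      fix e assume "e \<in> E"
      then obtain i j where "i < 3" "3 \<le> j" "j < 6" "e = {f i, f j}" unfolding VE(2) X Y by auto
      then have "e = f ` {i, j}" "{i, j} \<in> K33_E" unfolding K33_E_def by auto
      then show "e \<in> (\<lambda>e. f ` e) ` K33_E" by blast
    qed
    show "(\<lambda>e. f ` e) ` K33_E \<subseteq> E"
    proof
      fix e assume "e \<in> (\<lambda>e. f ` e) ` K33_E"
      then obtain i j where "i < 3" "3 \<le> j" "j < 6" "e = {f i, f j}" unfolding K33_E_def by auto
      then show "e \<in> E" unfolding VE(2) X Y
        by (intro CollectI exI[of _ "f i"] exI[of _ "f j"]) simp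
    qed
  qed
  then show ?thesis using f unfolding isomorphic_def K33_V_def VE(1) by blast
qed

theorem theorem5p3:
  fixes V :: "'a set" and E :: "'a set set"
  assumes "graph V E"
    and "bipartite V E"
    and "cyclically_3_connected V E"
  shows "isomorphic K33_V K33_E V E \<or> subdivision_of K4_V K4_E V E \<or>
         (\<exists>V' E'. subgraph V' E' V E \<and> subdivision_of K4_V K4_E V' E' \<and>
             \<not> (\<exists>C. is_cycle E' C \<and> set C = branch_vertices V' E'))"
proof -
  obtain VJ :: "'a set" and EJ where J: "three_connected VJ EJ" and S: "subdivision_of VJ EJ V E"
    using assms(3) unfolding cyclically_3_connected_def by blast
  obtain \<psi> Q where em: "embeds VJ EJ \<psi> Q E" and sub: "\<psi> ` VJ \<subseteq> V"
    and VE: "V = \<psi> ` VJ \<union> (\<Union>e\<in>EJ. set (Q e))" "E = (\<Union>e\<in>EJ. path_edges (Q e))"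
    using S unfolding subdivision_of_iff by blast
  obtain A where A: "\<forall>e\<in>E. card (e \<inter> A) = 1" using assms(2) unfolding bipartite_def by blast
  \<comment> \<open>The edges of \<open>J\<close> that stay single edges in \<open>H\<close>; the
    bipartition pulled back along \<open>\<psi>\<close> separates their ends.\<close>
  define D where "D = {e \<in> EJ. length (Q e) = 2}"
  interpret marked_graph VJ EJ D "{u. \<psi> u \<in> A}"
  proof
    fix u v assume uv: "{u, v} \<in> D"
    then have e: "{u, v} \<in> EJ" by (simp add: D_def)
    obtain x y where xy: "Q {u, v} = [x, y]"
      using uv by (auto simp: D_def length_Suc_conv numeral_2_eq_2)
    then have "{x, y} = {\<psi> u, \<psi> v}" using embedsD(3)[OF em e] by simp
    moreover have "{x, y} \<in> E" using embedsD(2)[OF em e] xy by simp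
    ultimately have c: "card ({\<psi> u, \<psi> v} \<inter> A) = 1" using A by metis
    have "u \<noteq> v" "u \<in> VJ" "v \<in> VJ" using graph_edge[OF three_connectedD(1)[OF J] e] by blast+
    then have "\<psi> u \<noteq> \<psi> v" using embedsD(1)[OF em] by (auto simp: inj_on_def)
    then show "u \<in> {u. \<psi> u \<in> A} \<longleftrightarrow> v \<notin> {u. \<psi> u \<in> A}"
      using c by (auto simp: Int_insert_left split: if_splits)
  qed (use J in \<open>auto simp: D_def\<close>)
  have gJ: "graph VJ EJ" using three_connectedD(1)[OF J] .
  show ?thesis
  proof (cases "good_K4 EJ D")
    case True
    then obtain a b c d p1 p2 p3 p4 p5 p6 where K: "K4sub EJ a b c d p1 p2 p3 p4 p5 p6"
      and nd: "\<not> direct D a b p1" "\<not> direct D a c p2" unfolding good_K4_def by blast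
    obtain \<phi> P where em4: "embeds K4_V K4_E \<phi> P EJ" and img: "\<phi> ` K4_V = {a, b, c, d}"
      and P: "P {0, 1} = a # p1 @ [b]" "P {0, 2} = a # p2 @ [c]" using K4sub_embeds[OF K] by blast
    have w: "walk EJ (a # p1 @ [b])" "walk EJ (a # p2 @ [c])" "walk EJ (b # p5 @ [d])"
      using K unfolding K4sub_def by blast+
    have "{a, b, c, d} \<subseteq> VJ" using walk_V[OF w(1)] walk_V[OF w(2)] walk_V[OF w(3)] by simp
    then have img': "\<phi> ` K4_V \<subseteq> VJ" using img by simp
    obtain R where R: "embeds K4_V K4_E (\<psi> \<circ> \<phi>) R E"
      and len: "\<forall>e\<in>K4_E. length (R e) = 2 \<longrightarrow> length (P e) = 2 \<and> length (Q {hd (P e), last (P e)}) = 2"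
      using embeds_trans[OF graph_K4 em4 em img' gJ] by blast
    have K4: "{0, 1} \<in> K4_E" "{0, 2} \<in> K4_E" unfolding K4_E_eq by simp_all
    \<comment> \<open>A lift of length 2 would make \<open>ab\<close> an unsubdivided edge and
      \<open>p1\<close> direct.\<close>
    have "length (R {0, 1}) \<noteq> 2"
    proof
      assume "length (R {0, 1}) = 2"
      then have "length (a # p1 @ [b]) = 2" "length (Q {a, b}) = 2" using len K4(1) P(1) by auto
      then show False using nd(1) w(1) by (simp add: direct_def D_def)
    qed
    moreover have "length (R {0, 2}) \<noteq> 2"
    proof
      assume "length (R {0, 2}) = 2"
      then have "length (a # p2 @ [c]) = 2" "length (Q {a, c}) = 2" using len K4(2) P(2) by auto
      then show False using nd(2) w(2) by (simp add: direct_def D_def)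
    qed
    moreover have "(\<psi> \<circ> \<phi>) ` K4_V \<subseteq> V" using img' sub by auto
    ultimately show ?thesis
      using embeds_subdivision[OF graph_K4 R assms(1) _ refl refl]
        K4_no_branch_cycle[OF R refl refl] by blast
  next
    case False
    \<comment> \<open>Either \<open>J\<close> is K_4 and \<open>H\<close> a subdivision of it, or a
      direct K_{3,3} is all of \<open>J\<close>, so nothing is subdivided and \<open>H\<close> is
      isomorphic to \<open>J\<close>.\<close>
    from marked_graph_cases[OF this] show ?thesis
    proof
      assume "card VJ = 4 \<and> EJ = {{u, v} | u v. u \<in> VJ \<and> v \<in> VJ \<and> u \<noteq> v}"
      then have "isomorphic K4_V K4_E VJ EJ" using complete_4_isomorphic by blast
      then show ?thesis
        using subdivision_of_relabel[OF _ _ graph_K4 S] unfolding isomorphic_def by blast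
    next
      assume "\<exists>X Y. K33_in X Y"
      then obtain X Y where K: "K33_in X Y" by blast
      note span = K33_spans[OF K False]
      have "isomorphic K33_V K33_E VJ EJ"
        using complete_bipartite_isomorphic[OF _ _ _ span(1,3)] K unfolding K33_in_def by blast
      moreover have "\<forall>e\<in>EJ. length (Q e) = 2" using span(2) unfolding D_def by blast
      then have "isomorphic VJ EJ V E" by (rule subdivision_of_direct[OF em VE gJ])
      ultimately show ?thesis using isomorphic_trans by blast
    qed
  qed
qed

end
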